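(* Let $X$ be a countable compact metrizable space. Then $X$ is a topological IFS-attractor if and only if its Cantor-Bendixson height $\operatorname{ht}(X)$ is a successor ordinal. If this is the case, then $X$ is homeomorphic to an IFS-attractor in the real line, i.e. to a compact set $Y\subset\mathbb{R}$ (with the usual distance) which is an IFS-attractor.
   Context: A countable compact metrizable space is scattered (every nonempty subspace has a point isolated in it). The Cantor-Bendixson derivative $X'$ is the set of accumulation points of $X$; define $X^{(0)}=X$, $X^{(\alpha+1)}=(X^{(\alpha)})'$ and $X^{(\alpha)}=\bigcap_{\beta<\alpha}X^{(\beta)}$ for limit $\alpha$. The (Cantor-Bendixson) height of a scattered space is $\operatorname{ht}(X)=\min\{\alpha : X^{(\alpha)}\text{ is discrete}\}$. On a metric space $(Y,d)$, a contraction is a map $f:Y\to Y$ for which there is $\alpha\in(0,1)$ with $d(f(x),f(y))\le\alpha\, d(x,y)$ for all $x,y\in Y$. A compact metric space $Y$ is an IFS-attractor if $Y=\bigcup_{i=1}^n f_i(Y)$ for some finite family of contractions $f_1,\dots,f_n:Y\to Y$. A space is a topological IFS-attractor if it is homeomorphic to some IFS-attractor (equivalently, it admits a compatible metric making it an IFS-attractor).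
   Formalization: Finite spaces have height 0, which is not a successor, yet are IFS-attractors, so the equivalence fails for them as stated; the formal version reads "the height is 0 or a successor ordinal", which agrees with the original for every infinite X. *)

theory Defs
  imports "HOL-Analysis.Analysis"
begin

section \<open>Countable ordinals\<close>

text \<open>
  Order types of well-orders on sets of natural numbers, that is, all countable ordinals
  (every well-order on a countable set is isomorphic to one on a subset of the naturals).
\<close>

quotient_type countable_ordinal = "nat rel" / partial: "\<lambda>r s. (r, s) \<in> ordIso"
proof (rule part_equivpI)
  have "Well_order ({} :: nat rel)"
    by simp
  then show "\<exists>r :: nat rel. (r, r) \<in> ordIso"
    using ordIso_reflexive by blast
  show "symp (\<lambda>r s :: nat rel. (r, s) \<in> ordIso)"
    using ordIso_symmetric by (intro sympI)
  show "transp (\<lambda>r s :: nat rel. (r, s) \<in> ordIso)"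
    using ordIso_transitive by (intro transpI)
qed

instantiation countable_ordinal :: "{zero, wellorder}"
begin

lift_definition zero_countable_ordinal :: countable_ordinal is "{}"
  by (intro ordIso_reflexive) simp

lift_definition less_eq_countable_ordinal :: "countable_ordinal \<Rightarrow> countable_ordinal \<Rightarrow> bool"
  is "\<lambda>r s. (r, s) \<in> ordLeq"
  by (meson ordIso_symmetric ordIso_ordLeq_trans ordLeq_ordIso_trans)

lift_definition less_countable_ordinal :: "countable_ordinal \<Rightarrow> countable_ordinal \<Rightarrow> bool"
  is "\<lambda>r s. (r, s) \<in> ordLess"
  by (meson ordIso_symmetric ordIso_ordLess_trans ordLess_ordIso_trans)

lemma wf_less_countable_ordinal: "wf {(\<alpha> :: countable_ordinal, \<beta>). \<alpha> < \<beta>}"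
proof -
  have "(rep_countable_ordinal \<alpha>, rep_countable_ordinal \<beta>) \<in> ordLess" if "\<alpha> < \<beta>" for \<alpha> \<beta>
    using that by (simp add: less_countable_ordinal.rep_eq)
  then have "{(\<alpha> :: countable_ordinal, \<beta>). \<alpha> < \<beta>} \<subseteq> inv_image ordLess rep_countable_ordinal"
    by (auto simp: inv_image_def)
  then show ?thesis
    using wf_ordLess wf_inv_image wf_subset by blast
qed

instance
proof
  fix \<alpha> \<beta> \<gamma> :: countable_ordinal
  show "\<alpha> < \<beta> \<longleftrightarrow> \<alpha> \<le> \<beta> \<and> \<not> \<beta> \<le> \<alpha>"
    by transfer (meson ordIso_iff_ordLeq ordLeq_Well_order_simp ordLess_imp_ordLeq
        not_ordLess_ordLeq ordLess_or_ordLeq)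
  show "\<alpha> \<le> \<alpha>"
    by transfer (meson ordIso_iff_ordLeq)
  show "\<alpha> \<le> \<beta> \<Longrightarrow> \<beta> \<le> \<gamma> \<Longrightarrow> \<alpha> \<le> \<gamma>"
    by transfer (rule ordLeq_transitive)
  show "\<alpha> \<le> \<beta> \<Longrightarrow> \<beta> \<le> \<alpha> \<Longrightarrow> \<alpha> = \<beta>"
    by transfer (simp add: ordIso_iff_ordLeq)
  show "\<alpha> \<le> \<beta> \<or> \<beta> \<le> \<alpha>"
    by transfer (meson ordIso_iff_ordLeq ordLeq_Well_order_simp ordLeq_total)
next
  fix P :: "countable_ordinal \<Rightarrow> bool" and \<alpha> :: countable_ordinal
  assume "\<And>\<alpha>. (\<And>\<beta>. \<beta> < \<alpha> \<Longrightarrow> P \<beta>) \<Longrightarrow> P \<alpha>"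
  then show "P \<alpha>"
    using wf_induct[OF wf_less_countable_ordinal, of P \<alpha>] by blast
qed

end

lemma zero_le_countable_ordinal: "0 \<le> (\<alpha> :: countable_ordinal)"
proof transfer
  fix r :: "nat rel"
  assume "(r, r) \<in> ordIso"
  then have "Well_order r"
    by (simp add: ordIso_def)
  then show "({}, r) \<in> ordLeq"
    by (simp add: ordLeq_def embed_def)
qed

definition succ_of :: "countable_ordinal \<Rightarrow> countable_ordinal \<Rightarrow> bool"
  where "succ_of \<beta> \<alpha> \<longleftrightarrow> \<beta> < \<alpha> \<and> (\<forall>\<gamma><\<alpha>. \<gamma> \<le> \<beta>)"

definition successor_ordinal :: "countable_ordinal \<Rightarrow> bool"
  where "successor_ordinal \<alpha> \<longleftrightarrow> (\<exists>\<beta>. succ_of \<beta> \<alpha>)"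

lemma the_pred_eq: "succ_of \<beta> \<alpha> \<Longrightarrow> (THE \<gamma>. succ_of \<gamma> \<alpha>) = \<beta>"
  by (rule the_equality) (auto simp: succ_of_def intro: order_antisym)

section \<open>Cantor--Bendixson derivatives and height\<close>

function cb_derivative :: "'a topology \<Rightarrow> countable_ordinal \<Rightarrow> 'a set" where
  "cb_derivative X \<alpha> =
    (if \<alpha> = 0 then topspace X
     else if successor_ordinal \<alpha> then
       (let A = cb_derivative X (THE \<beta>. succ_of \<beta> \<alpha>) in subtopology X A derived_set_of A)
     else (\<Inter>\<beta>\<in>{..<\<alpha>}. cb_derivative X \<beta>))"
  by auto
termination
proof (relation "inv_image {(\<alpha>, \<beta>). \<alpha> < \<beta>} snd")
  show "wf (inv_image {(\<alpha> :: countable_ordinal, \<beta>). \<alpha> < \<beta>} (snd :: 'a topology \<times> _ \<Rightarrow> _))"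
    by (intro wf_inv_image wf_less_countable_ordinal)
qed (auto simp: successor_ordinal_def the_pred_eq, simp add: succ_of_def)

declare cb_derivative.simps [simp del]

lemma cb_derivative_0: "cb_derivative X 0 = topspace X"
  by (subst cb_derivative.simps) simp

lemma cb_derivative_succ:
  assumes "succ_of \<beta> \<alpha>"
  shows "cb_derivative X \<alpha> =
    subtopology X (cb_derivative X \<beta>) derived_set_of cb_derivative X \<beta>"
proof -
  have "\<alpha> \<noteq> 0"
    using assms zero_le_countable_ordinal[of \<beta>] by (auto simp: succ_of_def)
  then show ?thesis
    using assms
    by (subst cb_derivative.simps) (auto simp: successor_ordinal_def the_pred_eq Let_def)
qed

lemma cb_derivative_limit:
  assumes "\<alpha> \<noteq> 0" "\<not> successor_ordinal \<alpha>"
  shows "cb_derivative X \<alpha> = (\<Inter>\<beta>\<in>{..<\<alpha>}. cb_derivative X \<beta>)"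
  using assms by (subst cb_derivative.simps) simp

text \<open>
  Only countable ordinals are searched. This is enough for a countable scattered space, whose
  derivatives strictly decrease until they reach the empty set, hence do so at a countable stage.
  Every finite discrete space, including the empty one, has height 0, which is not a successor.
\<close>

definition cb_height :: "'a topology \<Rightarrow> countable_ordinal"
  where "cb_height X = (LEAST \<alpha>.
    subtopology X (cb_derivative X \<alpha>) = discrete_topology (cb_derivative X \<alpha>))"

section \<open>IFS-attractors\<close>

definition contraction :: "'b metric \<Rightarrow> ('b \<Rightarrow> 'b) \<Rightarrow> bool"
  where "contraction Y f \<longleftrightarrow> f ` mspace Y \<subseteq> mspace Y \<and>
    (\<exists>\<alpha>. 0 < \<alpha> \<and> \<alpha> < 1 \<and>
      (\<forall>x\<in>mspace Y. \<forall>y\<in>mspace Y. mdist Y (f x) (f y) \<le> \<alpha> * mdist Y x y))"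

definition IFS_attractor :: "'b metric \<Rightarrow> bool"
  where "IFS_attractor Y \<longleftrightarrow> compact_space (mtopology_of Y) \<and>
    (\<exists>F. finite F \<and> (\<forall>f\<in>F. contraction Y f) \<and> mspace Y = (\<Union>f\<in>F. f ` mspace Y))"

text \<open>
  The attractor may be taken on the point type of \<open>X\<close>: a metric on any homeomorphic space
  transports along the homeomorphism to a metric on \<open>topspace X\<close>.
\<close>

definition topological_IFS_attractor :: "'a topology \<Rightarrow> bool"
  where "topological_IFS_attractor X \<longleftrightarrow>
    (\<exists>Y :: 'a metric. IFS_attractor Y \<and> X homeomorphic_space mtopology_of Y)"

end

theory Submission
  imports Defs
begin

text \<open>
  \<^bold>\<open>Necessity.\<close> Suppose that \<open>X\<close> is the union of its images under finitely many contractions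
  \<open>f\<close>. By compactness every derivative of \<open>X\<close> is covered by the images of that same derivative
  (\<open>cb_derivative_subset_images\<close>). Suppose that the height \<open>\<theta>\<close> is a limit. The derivative \<open>L\<close> of
  order \<open>\<theta>\<close> is finite and nonempty; split \<open>X\<close> into the closed cells of the points nearest to
  a given \<open>q \<in> L\<close>. If \<open>f q \<notin> L\<close>, then at some stage below \<open>\<theta>\<close> no point in the cell of \<open>q\<close>
  is mapped by \<open>f\<close> into the derivative, again by compactness. There are finitely many pairs
  \<open>(f, q)\<close>, so one derivative \<open>K\<close> of order below \<open>\<theta>\<close> is covered by the images of those cells
  whose centre \<open>q\<close> stays in \<open>L\<close>. There \<open>f\<close> shrinks the distance to \<open>L\<close> by a factor \<open>c < 1\<close>, so
  the supremum of the distances from points of \<open>K\<close> to \<open>L\<close> is at most \<open>c\<close> times itself, hence \<open>0\<close>.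
  Thus \<open>K \<subseteq> L\<close> is finite, against the minimality of \<open>\<theta>\<close> (\<open>attractor_height\<close>).

  \<^bold>\<open>Sufficiency.\<close> Call a clopen set a cone if it has a single point of maximal rank, its apex.
  A cone without its apex can be partitioned into cones of prescribed ranks \<open>a 0, a 1, \<dots>\<close>,
  provided that large enough ranks recur infinitely often (\<open>cone_decomposition\<close>). Fix labels \<open>a k\<close>
  that take every value below \<open>\<delta>\<close> infinitely often. Iterating the decomposition with these
  labels gives each point of a cone of rank \<open>\<beta> \<le> \<delta>\<close> an address, a finite word
  \<open>k\<^sub>1 k\<^sub>2 \<dots> k\<^sub>d\<close> with \<open>\<beta> > a k\<^sub>1 > a k\<^sub>2 > \<dots> > a k\<^sub>d\<close>. Letting the letter \<open>k\<close> act as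
  the similarity \<open>x \<mapsto> (3 + x) / 4 ^ (k + 1)\<close> turns the addresses into a compact set
  \<open>model a \<beta>\<close> of reals that is homeomorphic to the cone.

  A cone whose rank is the successor of \<open>\<delta>\<close> is decomposed once with the constant label \<open>\<delta>\<close>
  instead, which yields \<open>Y = {0} \<union> (\<Union>k. shrink k ` model a \<delta>)\<close>. The map \<open>x \<mapsto> x / 4\<close> moves
  each block of \<open>Y\<close> to the next one, so only block \<open>0\<close>, a copy of \<open>model a \<delta>\<close> scaled by \<open>1 / 4\<close>,
  remains to be covered. Here the shape of the addresses pays off: a final segment of a
  decreasing word is decreasing, so \<open>model a \<delta>\<close> is a subset of \<open>Y\<close>, and truncating each
  address to its longest prefix that is decreasing below \<open>\<delta>\<close> is a \<open>2\<close>-Lipschitz retraction of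
  \<open>Y\<close> onto it. Followed by \<open>shrink 0\<close> it contracts \<open>Y\<close> onto block \<open>0\<close> with ratio \<open>1 / 2\<close>
  (\<open>successor_model_half_ifs\<close>). This works for limit \<open>\<delta>\<close> too, although \<open>model a \<delta>\<close> is then not an
  attractor itself. A space with several points of maximal rank is a finite union of disjoint
  cones, and it becomes a union of translates of \<open>Y\<close>.
\<close>

section \<open>There are uncountably many countable ordinals\<close>

lemma strict_mono_wellorder_ge:
  fixes g :: "'a::wellorder \<Rightarrow> 'a"
  assumes "strict_mono g"
  shows "x \<le> g x"
proof (induction x rule: less_induct)
  case (less x)
  show ?case
  proof (rule ccontr)
    assume "\<not> x \<le> g x"
    then have "g x < x" by simp
    moreover from this have "g (g x) < g x"
      using assms by (simp add: strict_monoD)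
    ultimately show False
      using less[of "g x"] by simp
  qed
qed

text \<open>
  Otherwise the order of all countable ordinals would be isomorphic to a well-order \<open>r\<close> on the
  naturals. Then sending \<open>\<beta>\<close> to the type of the initial segment of \<open>r\<close> at \<open>\<beta>\<close> would be a strictly
  increasing map into the ordinals below the type of \<open>r\<close>; but such a map cannot move the type of
  \<open>r\<close> itself downwards.
\<close>
lemma uncountable_UNIV_countable_ordinal: "uncountable (UNIV :: countable_ordinal set)"
proof
  assume "countable (UNIV :: countable_ordinal set)"
  then obtain f :: "countable_ordinal \<Rightarrow> nat" where f: "inj f"
    by (rule countableE)
  define R where "R = {(\<alpha> :: countable_ordinal, \<beta>). \<alpha> \<le> \<beta>}"
  define r where "r = dir_image R f"
  have FR: "Field R = UNIV"
    by (auto simp: R_def Field_def)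
  have "R - Id = {(\<alpha>, \<beta>). \<alpha> < \<beta>}"
    by (auto simp: R_def)
  then have wf: "wf (R - Id)"
    using wf_less_countable_ordinal by simp
  have "refl R" "trans R" "antisym R" "total R"
    by (auto simp: R_def refl_on_def trans_def antisym_def total_on_def)
  with wf have "Well_order R"
    by (simp add: well_order_on_def linear_order_on_def partial_order_on_def preorder_on_def FR)
  then have wr: "Well_order r"
    unfolding r_def using f by (simp add: Well_order_dir_image FR)
  have Fr: "Field r = range f"
    by (simp add: r_def dir_image_Field FR)
  have r_iff: "(f \<alpha>, f \<beta>) \<in> r \<longleftrightarrow> \<alpha> \<le> \<beta>" for \<alpha> \<beta>
    using f by (auto simp: r_def dir_image_def R_def inj_eq)
  have under: "Order_Relation.underS r (f \<beta>) = f ` {..<\<beta>}" for \<beta>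
  proof -
    have "x \<in> range f" if "(x, f \<beta>) \<in> r" for x
      using that Fr by (auto simp: Field_def)
    then show ?thesis
      using f r_iff by (fastforce simp: Order_Relation.underS_def inj_eq)
  qed
  define s where "s \<beta> = Restr r (Order_Relation.underS r (f \<beta>))" for \<beta>
  have of: "wo_rel.ofilter r (Order_Relation.underS r (f \<beta>))" for \<beta>
    using wr by (simp add: wo_rel.underS_ofilter wo_rel_def)
  have ws: "Well_order (s \<beta>)" for \<beta>
    using wr by (simp add: s_def Well_order_Restr)
  have abs_less: "abs_countable_ordinal t < abs_countable_ordinal u \<longleftrightarrow> (t, u) \<in> ordLess"
    if "Well_order t" "Well_order u" for t u
    using that by (intro less_countable_ordinal.abs_eq ordIso_reflexive)
  define g where "g \<beta> = abs_countable_ordinal (s \<beta>)" for \<beta>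
  have "strict_mono g"
  proof (rule strict_monoI)
    fix \<alpha> \<beta> :: countable_ordinal
    assume "\<alpha> < \<beta>"
    then have "f ` {..<\<alpha>} < f ` {..<\<beta>}"
      using f by (auto simp: psubset_eq inj_image_subset_iff inj_image_eq_iff)
    then have "(s \<alpha>, s \<beta>) \<in> ordLess"
      unfolding s_def using ofilter_subset_ordLess[OF wr of of] under by simp
    then show "g \<alpha> < g \<beta>"
      by (simp add: g_def abs_less ws)
  qed
  moreover have "g (abs_countable_ordinal r) < abs_countable_ordinal r"
  proof -
    have "Order_Relation.underS r (f \<beta>) < Field r" for \<beta>
      using f unfolding under Fr by (auto simp: psubset_eq inj_image_eq_iff)
    then have "(s \<beta>, r) \<in> ordLess" for \<beta>
      unfolding s_def using ofilter_ordLess[OF wr of] by blast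
    then show ?thesis
      by (simp add: g_def abs_less ws wr)
  qed
  ultimately show False
    using strict_mono_wellorder_ge[of g "abs_countable_ordinal r"] by simp
qed

section \<open>Cantor--Bendixson derivatives of compact spaces\<close>

lemma succ_of_exists:
  assumes "\<alpha> < \<beta>"
  obtains \<gamma> where "succ_of \<alpha> \<gamma>" "\<gamma> \<le> \<beta>"
proof
  show "succ_of \<alpha> (LEAST \<gamma>. \<alpha> < \<gamma>)"
    unfolding succ_of_def using assms not_less_Least[of _ "\<lambda>\<gamma>. \<alpha> < \<gamma>"]
    by (auto intro: LeastI simp: not_less)
  show "(LEAST \<gamma>. \<alpha> < \<gamma>) \<le> \<beta>"
    using assms by (rule Least_le)
qed

text \<open>
  Both claims are carried through one induction: at a successor, the derived set lies inside the
  previous derivative because that derivative is closed.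
\<close>
lemma cb_derivative_closedin_antitone:
  assumes "Hausdorff_space X"
  shows "closedin X (cb_derivative X \<alpha>) \<and> (\<forall>\<beta><\<alpha>. cb_derivative X \<alpha> \<subseteq> cb_derivative X \<beta>)"
proof (induction \<alpha> rule: less_induct)
  case (less \<alpha>)
  consider "\<alpha> = 0" | \<beta> where "succ_of \<beta> \<alpha>" | "\<alpha> \<noteq> 0" "\<not> successor_ordinal \<alpha>"
    by (auto simp: successor_ordinal_def)
  then show ?case
  proof cases
    case 1
    then show ?thesis
      using zero_le_countable_ordinal by (metis cb_derivative_0 closedin_topspace leD)
  next
    case 2
    then have lt: "\<beta> < \<alpha>" and max: "\<And>\<gamma>. \<gamma> < \<alpha> \<Longrightarrow> \<gamma> \<le> \<beta>"
      by (auto simp: succ_of_def)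
    have *: "cb_derivative X \<alpha> = X derived_set_of cb_derivative X \<beta>"
      "cb_derivative X \<alpha> \<subseteq> cb_derivative X \<beta>"
      using 2 less[OF lt] by (auto simp: cb_derivative_succ derived_set_of_subtopology
          closedin_contains_derived_set)
    have "cb_derivative X \<beta> \<subseteq> cb_derivative X \<gamma>" if "\<gamma> < \<alpha>" for \<gamma>
      using max[OF that] less[OF lt] by (auto simp: order_le_less)
    then show ?thesis
      using * assms by (auto simp: closedin_derived_set_of)
  next
    case 3
    then have "{..<\<alpha>} \<noteq> {}"
      using zero_le_countable_ordinal[of \<alpha>] by (auto simp: order_le_less)
    then have "closedin X (\<Inter>\<beta>\<in>{..<\<alpha>}. cb_derivative X \<beta>)"
      using less by (intro closedin_Inter) auto
    then show ?thesis
      unfolding cb_derivative_limit[OF 3] by blast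
  qed
qed

lemmas cb_derivative_closedin = cb_derivative_closedin_antitone[THEN conjunct1]

lemma cb_derivative_subset_topspace:
  assumes "Hausdorff_space X"
  shows "cb_derivative X \<alpha> \<subseteq> topspace X"
  using cb_derivative_closedin[OF assms] closedin_subset by blast

lemma cb_derivative_antitone:
  assumes "Hausdorff_space X" "\<alpha> \<le> \<beta>"
  shows "cb_derivative X \<beta> \<subseteq> cb_derivative X \<alpha>"
  using cb_derivative_closedin_antitone[OF assms(1), of \<beta>] assms(2) by (auto simp: order_le_less)

lemma cb_derivative_succ_derived:
  assumes "Hausdorff_space X" "succ_of \<beta> \<alpha>"
  shows "cb_derivative X \<alpha> = X derived_set_of cb_derivative X \<beta>"
proof -
  have "closedin X (cb_derivative X \<beta>)"
    by (rule cb_derivative_closedin[OF assms(1)])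
  then show ?thesis
    using assms(2) by (auto simp: cb_derivative_succ derived_set_of_subtopology
          closedin_contains_derived_set)
qed

lemma cb_derivative_subset_derived:
  assumes "Hausdorff_space X" "\<alpha> < \<beta>"
  shows "cb_derivative X \<beta> \<subseteq> X derived_set_of cb_derivative X \<alpha>"
proof -
  obtain \<gamma> where "succ_of \<alpha> \<gamma>" "\<gamma> \<le> \<beta>"
    using succ_of_exists[OF assms(2)] .
  then show ?thesis
    using cb_derivative_antitone[OF assms(1), of \<gamma> \<beta>] cb_derivative_succ_derived[OF assms(1)]
    by simp
qed

lemma cb_derivative_discrete_iff:
  assumes "Hausdorff_space X"
  shows "subtopology X (cb_derivative X \<alpha>) = discrete_topology (cb_derivative X \<alpha>) \<longleftrightarrow>
    X derived_set_of cb_derivative X \<alpha> = {}"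
  using cb_derivative_closedin[OF assms, of \<alpha>]
  by (auto simp: subtopology_eq_discrete_topology_eq closedin_contains_derived_set)

text \<open>
  By the Baire category theorem: without isolated points, a countable set would be a countable
  union of nowhere dense singletons.
\<close>
lemma countable_closed_not_crowded:
  assumes "compact_space X" "Hausdorff_space X" "countable (topspace X)" "closedin X A" "A \<noteq> {}"
  shows "\<not> A \<subseteq> X derived_set_of A"
proof
  assume crowded: "A \<subseteq> X derived_set_of A"
  have AX: "A \<subseteq> topspace X"
    by (simp add: assms closedin_subset)
  let ?Z = "subtopology X A"
  have Z: "compact_space ?Z" "Hausdorff_space ?Z" "topspace ?Z = A"
    using assms AX by (auto simp: closedin_compact_space compact_space_subtopology
        Hausdorff_space_subtopology)
  have "?Z interior_of \<Union>((\<lambda>x. {x}) ` A) = {}"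
  proof (rule Baire_category_alt)
    show "completely_metrizable_space ?Z \<or> locally_compact_space ?Z \<and> regular_space ?Z"
      using Z by (simp add: compact_Hausdorff_imp_regular_space
          compact_imp_locally_compact_space)
    show "countable ((\<lambda>x. {x}) ` A)"
      using assms(3) AX countable_subset by blast
    fix T assume "T \<in> (\<lambda>x. {x}) ` A"
    then obtain x where x: "x \<in> A" "T = {x}" by blast
    have "\<not> openin ?Z {x}"
    proof
      assume "openin ?Z {x}"
      then obtain U where U: "openin X U" "{x} = U \<inter> A"
        by (auto simp: openin_subtopology)
      then have "x \<in> U" using x by blast
      moreover have "x \<in> X derived_set_of A"
        using x crowded by blast
      ultimately obtain y where "y \<noteq> x" "y \<in> A" "y \<in> U"
        using U(1) unfolding in_derived_set_of by blast
      then show False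
        using U by blast
    qed
    then have "?Z interior_of T = {}"
      using x by (metis interior_of_eq interior_of_subset subset_singletonD)
    moreover have "closedin ?Z T"
      using x Z by (simp add: closedin_Hausdorff_singleton)
    ultimately show "closedin ?Z T \<and> ?Z interior_of T = {}"
      by blast
  qed
  moreover have "\<Union>((\<lambda>x. {x}) ` A) = topspace ?Z"
    using Z by auto
  ultimately show False
    using Z assms(5) by (metis interior_of_topspace)
qed

text \<open>
  If no derivative were discrete, each would lose an isolated point at the next step. Points lost
  at different stages differ, so uncountably many stages would need uncountably many points.
  This shows that the least ordinal in the definition of \<^const>\<open>cb_height\<close> exists.
\<close>
lemma cb_derivative_eventually_discrete:
  assumes "compact_space X" "Hausdorff_space X" "countable (topspace X)"
  shows "\<exists>\<alpha>. X derived_set_of cb_derivative X \<alpha> = {}"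
proof (rule ccontr)
  assume "\<nexists>\<alpha>. X derived_set_of cb_derivative X \<alpha> = {}"
  then have "cb_derivative X \<alpha> \<noteq> {}" for \<alpha>
    by (metis derived_set_of_empty)
  then have "\<exists>x. x \<in> cb_derivative X \<alpha> - X derived_set_of cb_derivative X \<alpha>" for \<alpha>
    using countable_closed_not_crowded[OF assms cb_derivative_closedin[OF assms(2)]] by blast
  then obtain x where x: "\<And>\<alpha>. x \<alpha> \<in> cb_derivative X \<alpha> - X derived_set_of cb_derivative X \<alpha>"
    by metis
  have "x \<alpha> \<noteq> x \<beta>" if "\<alpha> < \<beta>" for \<alpha> \<beta>
    using cb_derivative_subset_derived[OF assms(2) that] x by (metis DiffD1 DiffD2 subsetD)
  then have "inj x"
    by (metis injI linorder_neqE)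
  moreover have "range x \<subseteq> topspace X"
    using x cb_derivative_subset_topspace[OF assms(2)] by blast
  then have "countable (range x)"
    using assms(3) countable_subset by blast
  ultimately show False
    using uncountable_UNIV_countable_ordinal countable_image_inj_on[of x UNIV] by simp
qed

lemma cb_height_discrete:
  assumes "compact_space X" "Hausdorff_space X" "countable (topspace X)"
  shows "X derived_set_of cb_derivative X (cb_height X) = {}"
    and "\<And>\<alpha>. \<alpha> < cb_height X \<Longrightarrow> X derived_set_of cb_derivative X \<alpha> \<noteq> {}"
proof -
  have eq: "cb_height X = (LEAST \<alpha>. X derived_set_of cb_derivative X \<alpha> = {})"
    by (simp add: cb_height_def cb_derivative_discrete_iff assms)
  show "X derived_set_of cb_derivative X (cb_height X) = {}"
    unfolding eq using cb_derivative_eventually_discrete[OF assms] by (rule LeastI_ex)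
  show "\<And>\<alpha>. \<alpha> < cb_height X \<Longrightarrow> X derived_set_of cb_derivative X \<alpha> \<noteq> {}"
    unfolding eq by (rule not_less_Least)
qed

lemma finite_cb_height_derivative:
  assumes "compact_space X" "Hausdorff_space X" "countable (topspace X)"
  shows "finite (cb_derivative X (cb_height X))"
  using cb_height_discrete(1)[OF assms] cb_derivative_subset_topspace[OF assms(2)]
    compact_space_imp_Bolzano_Weierstrass[OF assms(1), of "cb_derivative X (cb_height X)"]
  by blast

lemma homeomorphic_map_cb_derivative:
  assumes "homeomorphic_map X Y h" "Hausdorff_space X" "Hausdorff_space Y"
  shows "cb_derivative Y \<alpha> = h ` cb_derivative X \<alpha>"
proof (induction \<alpha> rule: less_induct)
  case (less \<alpha>)
  have inj: "inj_on h (topspace X)" and im: "h ` topspace X = topspace Y"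
    using assms(1) homeomorphic_imp_injective_map homeomorphic_imp_surjective_map by blast+
  consider "\<alpha> = 0" | \<beta> where "succ_of \<beta> \<alpha>" | "\<alpha> \<noteq> 0" "\<not> successor_ordinal \<alpha>"
    by (auto simp: successor_ordinal_def)
  then show ?case
  proof cases
    case 1
    then show ?thesis by (simp add: cb_derivative_0 im)
  next
    case 2
    then have "\<beta> < \<alpha>" by (simp add: succ_of_def)
    then show ?thesis
      using less homeomorphic_map_derived_set_of[OF assms(1)] 2 assms(2,3)
      by (simp add: cb_derivative_succ_derived cb_derivative_subset_topspace)
  next
    case 3
    then have "0 \<in> {..<\<alpha>}"
      using zero_le_countable_ordinal[of \<alpha>] by (auto simp: order_le_less)
    then have "h ` (\<Inter>\<beta>\<in>{..<\<alpha>}. cb_derivative X \<beta>) = (\<Inter>\<beta>\<in>{..<\<alpha>}. h ` cb_derivative X \<beta>)"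
      using cb_derivative_subset_topspace[OF assms(2)]
      by (intro image_INT[OF inj]) auto
    then show ?thesis
      using less by (simp add: cb_derivative_limit[OF 3])
  qed
qed

lemma homeomorphic_cb_height:
  assumes "X homeomorphic_space Y" "Hausdorff_space X"
  shows "cb_height X = cb_height Y"
proof -
  have Y: "Hausdorff_space Y"
    using assms homeomorphic_Hausdorff_space by blast
  obtain h where h: "homeomorphic_map X Y h"
    using assms(1) homeomorphic_space by blast
  have "Y derived_set_of cb_derivative Y \<alpha> = h ` (X derived_set_of cb_derivative X \<alpha>)" for \<alpha>
    using homeomorphic_map_cb_derivative[OF h assms(2) Y]
      homeomorphic_map_derived_set_of[OF h] cb_derivative_subset_topspace[OF assms(2)] by simp
  then show ?thesis
    by (simp add: cb_height_def cb_derivative_discrete_iff assms Y)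
qed

section \<open>Attractors do not have limit height\<close>

lemma nested_closed_Inter_nonempty:
  fixes I :: "'i::linorder set"
  assumes X: "compact_space X" and I: "I \<noteq> {}"
    and S: "\<And>i. i \<in> I \<Longrightarrow> closedin X (S i)" "\<And>i. i \<in> I \<Longrightarrow> S i \<noteq> {}"
      "\<And>i j. \<lbrakk>i \<in> I; j \<in> I; i \<le> j\<rbrakk> \<Longrightarrow> S j \<subseteq> S i"
  shows "(\<Inter>i\<in>I. S i) \<noteq> {}"
proof -
  have "\<Inter>\<F> \<noteq> {}" if F: "finite \<F>" "\<F> \<subseteq> S ` I" for \<F>
  proof -
    obtain J where J: "finite J" "J \<subseteq> I" "\<F> = S ` J"
      using F finite_subset_image by meson
    show ?thesis
    proof (cases "J = {}")
      case False
      have "S (Max J) \<subseteq> S i" if "i \<in> J" for i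
        using that J False by (intro S(3)) (auto intro: Max_in[THEN subsetD[OF J(2)]])
      then have "S (Max J) \<subseteq> \<Inter>\<F>"
        using J(3) by blast
      moreover have "S (Max J) \<noteq> {}"
        using S(2) Max_in[OF J(1) False] J(2) by blast
      ultimately show ?thesis
        by blast
    qed (use J in simp)
  qed
  moreover have "\<forall>C\<in>S ` I. closedin X C"
    using S(1) by blast
  ultimately show ?thesis
    by (intro compact_space_fip[THEN iffD1, rule_format, OF X]) simp
qed

text \<open>
  Suppose that no accumulation point of \<open>A\<close> lies over \<open>y\<close>. Then each point of \<open>A\<close> over \<open>y\<close> is isolated
  in \<open>A\<close>. Removing all these points leaves a compact set, whose image is closed and misses \<open>y\<close>, so
  \<open>y\<close> does not accumulate the image of \<open>A\<close>.
\<close>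
lemma derived_set_of_image_subset:
  assumes f: "continuous_map X Y f" and X: "compact_space X" and Y: "Hausdorff_space Y"
    and A: "closedin X A"
  shows "Y derived_set_of (f ` A) \<subseteq> f ` (X derived_set_of A)"
proof
  fix y assume y: "y \<in> Y derived_set_of (f ` A)"
  show "y \<in> f ` (X derived_set_of A)"
  proof (rule ccontr)
    assume not: "y \<notin> f ` (X derived_set_of A)"
    have AX: "A \<subseteq> topspace X"
      using A closedin_subset by blast
    \<comment> \<open>Open sets that isolate the points of the fibre; their union is removed from \<open>A\<close>.\<close>
    define \<U> where "\<U> = {U. openin X U \<and> (\<exists>x\<in>A. f x = y \<and> U \<inter> A = {x})}"
    have isolated: "x \<in> \<Union>\<U>" if x: "x \<in> A" "f x = y" for x
    proof -
      have "x \<notin> X derived_set_of A"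
        using not x by blast
      then obtain U where U: "openin X U" "x \<in> U" "\<not> (\<exists>z. z \<noteq> x \<and> z \<in> A \<and> z \<in> U)"
        using x AX unfolding in_derived_set_of by blast
      then have "U \<inter> A = {x}"
        using x by blast
      then show ?thesis
        using U x unfolding \<U>_def by blast
    qed
    have "openin X (\<Union>\<U>)"
      by (rule openin_Union) (simp add: \<U>_def)
    then have "closedin X (A - \<Union>\<U>)"
      using A by (simp add: closedin_diff)
    then have "closedin Y (f ` (A - \<Union>\<U>))"
      using f X Y by (meson closedin_compact_space compactin_imp_closedin image_compactin)
    moreover have "y \<in> topspace Y"
      using y by (simp add: in_derived_set_of)
    moreover have "y \<notin> f ` (A - \<Union>\<U>)"
      using isolated by blast
    ultimately obtain z where z: "z \<noteq> y" "z \<in> f ` A" "z \<in> topspace Y - f ` (A - \<Union>\<U>)"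
      using y unfolding in_derived_set_of by (metis DiffI closedin_def)
    then obtain x U where x: "x \<in> A" "z = f x" "x \<in> U" "U \<in> \<U>"
      by blast
    obtain x' where x': "f x' = y" "U \<inter> A = {x'}"
      using x(4) unfolding \<U>_def by blast
    then have "x = x'"
      using x(1,3) by blast
    then show False
      using x'(1) x(2) z(1) by blast
  qed
qed

lemma finite_bounded_below_limit:
  fixes b :: "'f \<Rightarrow> 'o::linorder"
  assumes "finite F" "\<And>f. f \<in> F \<Longrightarrow> b f < \<mu>" "\<beta>\<^sub>0 < \<mu>"
  shows "\<exists>\<beta><\<mu>. \<forall>f\<in>F. b f \<le> \<beta>"
  using assms by (intro exI[of _ "Max (insert \<beta>\<^sub>0 (b ` F))"]) auto

text \<open>
  At a successor, derived sets commute with finite unions and accumulation points of images come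
  from accumulation points. At a limit, the parts of a fibre that lie in the earlier derivatives
  are closed and decreasing, so an empty intersection means that one of them is empty; as there are
  finitely many maps, a single stage serves all of them.
\<close>
lemma cb_derivative_subset_images:
  assumes X: "compact_space X" "Hausdorff_space X" and F: "finite F"
    and cont: "\<And>f. f \<in> F \<Longrightarrow> continuous_map X X f"
    and cover: "topspace X = (\<Union>f\<in>F. f ` topspace X)"
  shows "cb_derivative X \<alpha> \<subseteq> (\<Union>f\<in>F. f ` cb_derivative X \<alpha>)"
proof (induction \<alpha> rule: less_induct)
  case (less \<alpha>)
  consider "\<alpha> = 0" | \<beta> where "succ_of \<beta> \<alpha>" | "\<alpha> \<noteq> 0" "\<not> successor_ordinal \<alpha>"
    by (auto simp: successor_ordinal_def)
  then show ?case
  proof cases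
    case 1
    then show ?thesis
      using cover by (simp add: cb_derivative_0)
  next
    case 2
    let ?A = "cb_derivative X \<beta>"
    have "\<beta> < \<alpha>"
      using 2 by (simp add: succ_of_def)
    then have "?A \<subseteq> (\<Union>f\<in>F. f ` ?A)"
      by (rule less)
    then have "X derived_set_of ?A \<subseteq> X derived_set_of (\<Union>f\<in>F. f ` ?A)"
      by (rule derived_set_of_mono)
    also have "\<dots> = (\<Union>f\<in>F. X derived_set_of (f ` ?A))"
      using derived_set_of_Union[of "(\<lambda>f. f ` ?A) ` F" X] F by simp
    also have "\<dots> \<subseteq> (\<Union>f\<in>F. f ` (X derived_set_of ?A))"
      using derived_set_of_image_subset[OF cont X cb_derivative_closedin[OF X(2)]] by blast
    finally show ?thesis
      by (simp add: cb_derivative_succ_derived[OF X(2) 2])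
  next
    case 3
    show ?thesis
    proof
      fix y assume y: "y \<in> cb_derivative X \<alpha>"
      have yX: "y \<in> topspace X"
        using y cb_derivative_subset_topspace[OF X(2)] by blast
      define S where "S f \<beta> = cb_derivative X \<beta> \<inter> {x \<in> topspace X. f x \<in> {y}}" for f \<beta>
      have pos: "0 < \<alpha>"
        using 3(1) zero_le_countable_ordinal[of \<alpha>] by (simp add: order_le_less)
      show "y \<in> (\<Union>f\<in>F. f ` cb_derivative X \<alpha>)"
      proof (rule ccontr)
        assume not: "y \<notin> (\<Union>f\<in>F. f ` cb_derivative X \<alpha>)"
        have "\<exists>\<beta><\<alpha>. S f \<beta> = {}" if f: "f \<in> F" for f
        proof (rule ccontr)
          assume nonempty: "\<not> (\<exists>\<beta><\<alpha>. S f \<beta> = {})"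
          have "(\<Inter>\<beta>\<in>{..<\<alpha>}. S f \<beta>) \<noteq> {}"
          proof (rule nested_closed_Inter_nonempty[OF X(1)])
            show "{..<\<alpha>} \<noteq> {}"
              using pos by blast
            show "closedin X (S f \<beta>)" for \<beta>
              unfolding S_def using cb_derivative_closedin[OF X(2)] cont[OF f] yX X(2)
              by (intro closedin_Int closedin_continuous_map_preimage)
                (auto simp: closedin_Hausdorff_singleton)
            show "S f \<gamma> \<subseteq> S f \<beta>" if "\<beta> \<le> \<gamma>" for \<beta> \<gamma>
              unfolding S_def using cb_derivative_antitone[OF X(2) that] by blast
          qed (use nonempty in blast)
          then obtain x where "\<forall>\<beta><\<alpha>. x \<in> S f \<beta>"
            by auto
          then have "x \<in> cb_derivative X \<alpha>" "f x = y"
            using pos unfolding S_def cb_derivative_limit[OF 3] by auto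
          then show False
            using not f by blast
        qed
        then obtain b where b: "\<And>f. f \<in> F \<Longrightarrow> b f < \<alpha> \<and> S f (b f) = {}"
          by metis
        obtain \<beta> where \<beta>: "\<beta> < \<alpha>" "\<forall>f\<in>F. b f \<le> \<beta>"
          using finite_bounded_below_limit[OF F, of b \<alpha> 0] b pos by blast
        have "y \<in> cb_derivative X \<beta>"
          using y cb_derivative_antitone[OF X(2) less_imp_le[OF \<beta>(1)]] by blast
        then obtain f x where fx: "f \<in> F" "x \<in> cb_derivative X \<beta>" "f x = y"
          using less[OF \<beta>(1)] by blast
        then have "x \<in> S f (b f)"
          using cb_derivative_antitone[OF X(2), of "b f" \<beta>] \<beta>(2)
            cb_derivative_subset_topspace[OF X(2)] unfolding S_def by blast
        then show False
          using b fx(1) by blast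
      qed
    qed
  qed
qed

lemma contraction_imp_continuous_map:
  assumes "contraction Y f"
  shows "continuous_map (mtopology_of Y) (mtopology_of Y) f"
proof -
  have "Lipschitz_continuous_map Y Y f"
    using assms unfolding contraction_def Lipschitz_continuous_map_def by blast
  then show ?thesis
    by (rule Lipschitz_continuous_imp_continuous_map)
qed

lemma closedin_voronoi_cell:
  assumes "L \<subseteq> mspace Y" "q \<in> L"
  shows "closedin (mtopology_of Y) {x \<in> mspace Y. \<forall>p\<in>L. mdist Y x q \<le> mdist Y x p}"
proof -
  have cont: "continuous_map (mtopology_of Y) euclideanreal (\<lambda>x. mdist Y x p)" if "p \<in> L" for p
  proof -
    have "Lipschitz_continuous_map Y Y (\<lambda>x. x)" "Lipschitz_continuous_map Y Y (\<lambda>x. p)"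
      using that assms(1) by (auto simp: Lipschitz_continuous_map_const) (auto simp: Lipschitz_continuous_map_def intro: exI[of _ 1])
    then show ?thesis
      using Lipschitz_continuous_imp_continuous_map[OF Lipschitz_continuous_map_mdist] by force
  qed
  have "closedin (mtopology_of Y) {x \<in> topspace (mtopology_of Y). mdist Y x q - mdist Y x p \<in> {..0}}"
    if "p \<in> L" for p
    using cont that assms(2)
    by (intro closedin_continuous_map_preimage[of _ euclideanreal] continuous_map_diff) auto
  then have "closedin (mtopology_of Y)
      (\<Inter>p\<in>L. {x \<in> topspace (mtopology_of Y). mdist Y x q - mdist Y x p \<in> {..0}})"
    using assms(2) by (intro closedin_Inter) auto
  also have "(\<Inter>p\<in>L. {x \<in> topspace (mtopology_of Y). mdist Y x q - mdist Y x p \<in> {..0}}) =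
      {x \<in> mspace Y. \<forall>p\<in>L. mdist Y x q \<le> mdist Y x p}"
    using assms(2) by auto
  finally show ?thesis .
qed

lemma uniform_contraction_constant:
  assumes "finite F" "\<And>f. f \<in> F \<Longrightarrow> contraction Y f"
  obtains c where "0 \<le> c" "c < 1"
    "\<And>f x y. \<lbrakk>f \<in> F; x \<in> mspace Y; y \<in> mspace Y\<rbrakk> \<Longrightarrow> mdist Y (f x) (f y) \<le> c * mdist Y x y"
proof -
  obtain r where r: "\<And>f. f \<in> F \<Longrightarrow> 0 < r f \<and> r f < 1 \<and>
      (\<forall>x\<in>mspace Y. \<forall>y\<in>mspace Y. mdist Y (f x) (f y) \<le> r f * mdist Y x y)"
    using assms(2) unfolding contraction_def by metis
  let ?c = "Max (insert 0 (r ` F))"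
  have le: "r f \<le> ?c" if "f \<in> F" for f
    using assms(1) that by auto
  show thesis
  proof
    show "0 \<le> ?c" "?c < 1"
      using assms(1) r by auto
    fix f x y assume "f \<in> F" "x \<in> mspace Y" "y \<in> mspace Y"
    then show "mdist Y (f x) (f y) \<le> ?c * mdist Y x y"
      using r le by (meson mdist_nonneg mult_right_mono order_trans)
  qed
qed

text \<open>
  At a limit height, only finitely many maps and centres have to be discarded, and each is
  harmless from some stage below the height on; what survives at a common later stage contracts
  towards the finite last derivative.
\<close>
lemma attractor_height:
  assumes Y: "IFS_attractor Y" "countable (mspace Y)"
  shows "cb_height (mtopology_of Y) = 0 \<or> successor_ordinal (cb_height (mtopology_of Y))"
proof (rule ccontr)
  let ?X = "mtopology_of Y"
  let ?\<theta> = "cb_height ?X"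
  assume "\<not> ?thesis"
  then have limit: "?\<theta> \<noteq> 0" "\<not> successor_ordinal ?\<theta>"
    by auto
  have X: "compact_space ?X" "Hausdorff_space ?X" "countable (topspace ?X)"
    using Y by (simp_all add: IFS_attractor_def)
      (simp add: mtopology_of_def Metric_space.Hausdorff_space_mtopology)
  obtain F where F: "finite F" "\<And>f. f \<in> F \<Longrightarrow> contraction Y f"
      "mspace Y = (\<Union>f\<in>F. f ` mspace Y)"
    using Y unfolding IFS_attractor_def by blast
  have f_Y: "f x \<in> mspace Y" if "f \<in> F" "x \<in> mspace Y" for f x
    using F(3) that by blast
  define L where "L = cb_derivative ?X ?\<theta>"
  have pos: "0 < ?\<theta>"
    using limit(1) zero_le_countable_ordinal[of ?\<theta>] by (simp add: order_le_less)
  have L_eq: "L = (\<Inter>\<beta>\<in>{..<?\<theta>}. cb_derivative ?X \<beta>)"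
    unfolding L_def by (rule cb_derivative_limit[OF limit])
  have L: "finite L" "L \<subseteq> mspace Y"
    using finite_cb_height_derivative[OF X] cb_derivative_subset_topspace[OF X(2)]
    by (auto simp: L_def)
  have nonempty: "cb_derivative ?X \<beta> \<noteq> {}" if "\<beta> < ?\<theta>" for \<beta>
    using cb_height_discrete(2)[OF X that] by (metis derived_set_of_empty)
  have "L \<noteq> {}"
    unfolding L_eq using pos nonempty cb_derivative_closedin[OF X(2)] cb_derivative_antitone[OF X(2)]
    by (intro nested_closed_Inter_nonempty[OF X(1)]) auto
  define cell where "cell q = {x \<in> mspace Y. \<forall>p\<in>L. mdist Y x q \<le> mdist Y x p}" for q
  have cell_exists: "\<exists>q\<in>L. x \<in> cell q" if "x \<in> mspace Y" for x
  proof -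
    obtain q where q: "q \<in> L" "Min (mdist Y x ` L) = mdist Y x q"
      using obtains_MIN[OF L(1) \<open>L \<noteq> {}\<close>] by metis
    then have "mdist Y x q \<le> mdist Y x p" if "p \<in> L" for p
      using L(1) that by (metis Min_le finite_imageI image_eqI)
    then show ?thesis
      using q(1) that by (auto simp: cell_def)
  qed
  \<comment> \<open>A point in all of the sets \<open>?S \<beta>\<close> would lie in \<open>L\<close> and in the cell of \<open>q\<close>, hence be \<open>q\<close>.\<close>
  have avoid: "\<exists>\<beta><?\<theta>. \<forall>x\<in>cb_derivative ?X \<beta> \<inter> cell q. f x \<notin> cb_derivative ?X \<beta>"
    if f: "f \<in> F" and q: "q \<in> L" "f q \<notin> L" for f q
  proof (rule ccontr)
    assume no: "\<not> ?thesis"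
    let ?S = "\<lambda>\<beta>. cb_derivative ?X \<beta> \<inter> (cell q \<inter> {x \<in> topspace ?X. f x \<in> cb_derivative ?X \<beta>})"
    have "(\<Inter>\<beta>\<in>{..<?\<theta>}. ?S \<beta>) \<noteq> {}"
    proof (rule nested_closed_Inter_nonempty[OF X(1)])
      show "{..<?\<theta>} \<noteq> {}"
        using pos by blast
      show "closedin ?X (?S \<beta>)" for \<beta>
        using cb_derivative_closedin[OF X(2)] closedin_voronoi_cell[OF L(2) q(1)]
          contraction_imp_continuous_map[OF F(2)[OF f]] unfolding cell_def
        by (intro closedin_Int closedin_continuous_map_preimage[of ?X ?X]) auto
      show "?S \<gamma> \<subseteq> ?S \<beta>" if "\<beta> \<le> \<gamma>" for \<beta> \<gamma>
        using cb_derivative_antitone[OF X(2) that] by blast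
      show "?S \<beta> \<noteq> {}" if "\<beta> \<in> {..<?\<theta>}" for \<beta>
        using no that unfolding cell_def by auto
    qed
    then obtain x where x: "\<forall>\<beta><?\<theta>. x \<in> ?S \<beta>"
      by auto
    then have "x \<in> L" "f x \<in> L" "x \<in> cell q"
      using pos unfolding L_eq by auto
    then have "mdist Y x q \<le> mdist Y x x" "x \<in> mspace Y" "q \<in> mspace Y"
      using L(2) q(1) unfolding cell_def by auto
    then have "x = q"
      by (metis mdist_nonneg mdist_zero order_antisym)
    then show False
      using \<open>f x \<in> L\<close> q(2) by simp
  qed
  define B where "B = {(f, q). f \<in> F \<and> q \<in> L \<and> f q \<notin> L}"
  have "finite B"
    using F(1) L(1) unfolding B_def by (rule_tac finite_subset[of _ "F \<times> L"]) auto
  obtain b where b: "\<And>f q. (f, q) \<in> B \<Longrightarrow> b (f, q) < ?\<theta> \<and>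
      (\<forall>x\<in>cb_derivative ?X (b (f, q)) \<inter> cell q. f x \<notin> cb_derivative ?X (b (f, q)))"
  proof -
    have "\<forall>z\<in>B. \<exists>\<beta>. \<beta> < ?\<theta> \<and>
        (\<forall>x\<in>cb_derivative ?X \<beta> \<inter> cell (snd z). fst z x \<notin> cb_derivative ?X \<beta>)"
      using avoid unfolding B_def by auto
    then show thesis
      using that by (metis fst_conv snd_conv)
  qed
  obtain \<beta> where \<beta>: "\<beta> < ?\<theta>" "\<forall>z\<in>B. b z \<le> \<beta>"
    using finite_bounded_below_limit[OF \<open>finite B\<close>, of b ?\<theta> 0] b pos by fast
  define K where "K = cb_derivative ?X \<beta>"
  have K: "K \<subseteq> mspace Y" "K \<subseteq> (\<Union>f\<in>F. f ` K)"
    using cb_derivative_subset_topspace[OF X(2)]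
      cb_derivative_subset_images[OF X(1,2) F(1) contraction_imp_continuous_map[OF F(2)]] F(3)
    by (auto simp: K_def)
  have good: "f q \<in> L" if "f \<in> F" "q \<in> L" "x \<in> K" "x \<in> cell q" "f x \<in> K" for f q x
  proof (rule ccontr)
    assume "f q \<notin> L"
    then have "(f, q) \<in> B"
      using that by (simp add: B_def)
    then show False
      using b[of f q] \<beta>(2) that cb_derivative_antitone[OF X(2), of "b (f, q)" \<beta>]
      unfolding K_def by blast
  qed
  obtain c where c: "0 \<le> c" "c < 1"
    "\<And>f x y. \<lbrakk>f \<in> F; x \<in> mspace Y; y \<in> mspace Y\<rbrakk> \<Longrightarrow> mdist Y (f x) (f y) \<le> c * mdist Y x y"
    using uniform_contraction_constant[of F Y] F(1,2) by blast
  define D where "D x = Min (mdist Y x ` L)" for x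
  have D_le: "D x \<le> mdist Y x q" if "q \<in> L" for x q
    unfolding D_def using L(1) that by simp
  have D_cell: "D x = mdist Y x q" if "q \<in> L" "x \<in> cell q" for x q
    unfolding D_def using L(1) that by (intro Min_eqI) (auto simp: cell_def)
  have D_nonneg: "0 \<le> D x" for x
    unfolding D_def using L(1) \<open>L \<noteq> {}\<close> by simp
  have "Metric_space.mbounded (mspace Y) (mdist Y) (mspace Y)"
    using X(1) by (intro Metric_space.compactin_imp_mbounded)
      (simp_all add: compact_space_def, simp add: mtopology_of_def)
  then obtain R where R: "\<And>x y. \<lbrakk>x \<in> mspace Y; y \<in> mspace Y\<rbrakk> \<Longrightarrow> mdist Y x y \<le> R"
    unfolding Metric_space.mbounded_alt[OF Metric_space_mspace_mdist] by blast
  have "bdd_above (D ` K)"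
  proof (rule bdd_aboveI2)
    fix x assume "x \<in> K"
    then show "D x \<le> R"
      using D_le R L(2) K(1) \<open>L \<noteq> {}\<close> by (meson ex_in_conv order_trans subsetD)
  qed
  moreover have "K \<noteq> {}"
    unfolding K_def by (rule nonempty[OF \<beta>(1)])
  ultimately have sup: "D x \<le> (SUP x\<in>K. D x)" if "x \<in> K" for x
    using that by (simp add: cSUP_upper)
  \<comment> \<open>For \<open>x = f y\<close> with \<open>y\<close> nearest to \<open>q\<close>, the point \<open>f q\<close> of \<open>L\<close> bounds the distance of \<open>x\<close> from \<open>L\<close>.\<close>
  have step: "D x \<le> c * (SUP x\<in>K. D x)" if x: "x \<in> K" for x
  proof -
    obtain f y where fy: "f \<in> F" "y \<in> K" "x = f y"
      using x K(2) by blast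
    obtain q where q: "q \<in> L" "y \<in> cell q"
      using cell_exists fy(2) K(1) by blast
    have "D x \<le> mdist Y (f y) (f q)"
      using good[OF fy(1) q(1) fy(2) q(2)] x fy(3) D_le by simp
    also have "\<dots> \<le> c * mdist Y y q"
      using c(3)[OF fy(1)] fy(2) q(1) K(1) L(2) by blast
    also have "\<dots> \<le> c * (SUP x\<in>K. D x)"
      using sup[OF fy(2)] D_cell[OF q] c(1) by (simp add: mult_left_mono)
    finally show ?thesis .
  qed
  have "(SUP x\<in>K. D x) \<le> c * (SUP x\<in>K. D x)"
    using \<open>K \<noteq> {}\<close> step by (rule cSUP_least)
  then have "(1 - c) * (SUP x\<in>K. D x) \<le> 0"
    by (simp add: algebra_simps)
  then have le0: "(SUP x\<in>K. D x) \<le> 0"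
    using c(2) by (simp add: mult_le_0_iff)
  have "K \<subseteq> L"
  proof
    fix x assume x: "x \<in> K"
    obtain q where q: "q \<in> L" "x \<in> cell q"
      using cell_exists x K(1) by blast
    have "mdist Y x q = 0"
      using sup[OF x] le0 D_cell[OF q] by (metis mdist_nonneg order_antisym order_trans)
    then show "x \<in> L"
      using q(1) x K(1) L(2) by (metis mdist_zero subsetD)
  qed
  then have "finite K"
    using L(1) finite_subset by blast
  then have "?X derived_set_of K = {}"
    using X(2) by (simp add: derived_set_of_finite)
  then show False
    using cb_height_discrete(2)[OF X \<beta>(1)] by (simp add: K_def)
qed

section \<open>Decomposing ranked spaces into cones\<close>

text \<open>
  The Cantor--Bendixson rank enters the construction only through two local properties: near each
  point the rank drops, and every smaller rank occurs arbitrarily close to the point.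
\<close>
locale ranked_space =
  fixes X :: "'a topology" and rk :: "'a \<Rightarrow> 'o::wellorder"
  assumes compact: "compact_space X" and Hausdorff: "Hausdorff_space X"
    and countable: "countable (topspace X)"
    and clopen_base: "\<lbrakk>openin X U; x \<in> U\<rbrakk> \<Longrightarrow> \<exists>C. openin X C \<and> closedin X C \<and> x \<in> C \<and> C \<subseteq> U"
    and rank_less: "x \<in> topspace X \<Longrightarrow> \<exists>U. openin X U \<and> x \<in> U \<and> (\<forall>y\<in>U - {x}. rk y < rk x)"
    and rank_attained: "\<lbrakk>openin X U; x \<in> U; \<gamma> < rk x\<rbrakk> \<Longrightarrow> \<exists>y\<in>U. rk y = \<gamma>"
begin

text \<open>
  The point \<open>p\<close> is the apex. As \<open>C\<close> is compact, disjoint clopen pieces that exhaust \<open>C - {p}\<close> can only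
  accumulate at \<open>p\<close>.
\<close>
definition cone :: "'a \<Rightarrow> 'a set \<Rightarrow> bool"
  where "cone p C \<longleftrightarrow> openin X C \<and> closedin X C \<and> p \<in> C \<and> (\<forall>y\<in>C - {p}. rk y < rk p)"

lemma small_cone:
  assumes "openin X U" "x \<in> U"
  obtains C where "cone x C" "C \<subseteq> U"
proof -
  have "x \<in> topspace X"
    using assms openin_subset by blast
  then obtain V where V: "openin X V" "x \<in> V" "\<forall>y\<in>V - {x}. rk y < rk x"
    using rank_less by blast
  obtain C where "openin X C" "closedin X C" "x \<in> C" "C \<subseteq> U \<inter> V"
    using clopen_base[of "U \<inter> V" x] assms V by (auto simp: openin_Int)
  then show thesis
    using V(3) by (intro that[of C]) (auto simp: cone_def)
qed

lemma openin_remove_point: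
  assumes "openin X U"
  shows "openin X (U - {p})"
proof (cases "p \<in> topspace X")
  case True
  then show ?thesis
    using assms Hausdorff by (simp add: closedin_Hausdorff_singleton openin_diff)
next
  case False
  then have "U - {p} = U"
    using assms openin_subset by blast
  then show ?thesis
    using assms by simp
qed

text \<open>
  A small neighbourhood of a point \<open>x\<close> of rank below \<open>\<gamma>\<close> can be added to a cone of rank \<open>\<gamma>\<close> without
  changing its apex. So whenever a cone is cut off, it can swallow a given point of smaller or equal
  rank; this is how a sequence of cuts is made to exhaust everything but \<open>p\<close>.
\<close>
lemma peel_cone:
  assumes "cone p R" "\<gamma> < rk p" "x \<in> R - {p}"
  obtains e D where "cone e D" "rk e = \<gamma>" "D \<subseteq> R - {p}" "rk x \<le> \<gamma> \<Longrightarrow> x \<in> D"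
proof -
  have R: "openin X (R - {p})" "openin X R" "p \<in> R"
    using assms(1) by (auto simp: cone_def openin_remove_point)
  consider "rk x = \<gamma>" | "rk x \<noteq> \<gamma>" by blast
  then show thesis
  proof cases
    case 1
    obtain D where "cone x D" "D \<subseteq> R - {p}"
      using small_cone[OF R(1) assms(3)] .
    then show thesis
      using 1 by (intro that[of x D]) (auto simp: cone_def)
  next
    case 2
    obtain e where e: "e \<in> R" "rk e = \<gamma>"
      using rank_attained[OF R(2,3) assms(2)] by blast
    then have "e \<in> R - {p}" "e \<noteq> x"
      using assms(2) 2 by auto
    then obtain E where E: "cone e E" "E \<subseteq> R - {p}"
      using small_cone[OF R(1)] by blast
    obtain F where F: "cone x F" "F \<subseteq> R - {p}"
      using small_cone[OF R(1) assms(3)] .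
    show thesis
    proof (cases "rk x < \<gamma>")
      case True
      have "rk y < rk e" if "y \<in> F" for y
      proof (cases "y = x")
        case False
        then have "rk y < rk x"
          using F(1) that by (simp add: cone_def)
        then show ?thesis
          using True e(2) by simp
      qed (use True e(2) in simp)
      then have "cone e (E \<union> F)"
        using E(1) F(1) by (auto simp: cone_def)
      moreover have "x \<in> F"
        using F(1) by (simp add: cone_def)
      ultimately show thesis
        using E(2) F(2) e(2) by (intro that[of e "E \<union> F"]) auto
    next
      case False
      then show thesis
        using E e 2 by (intro that[of e E]) auto
    qed
  qed
qed

text \<open>
  The cones are cut off one label at a time. Each swallows, if its rank allows it, the first
  remaining point in a fixed enumeration of the space. A point of rank \<open>\<gamma>\<close> is first in line from some
  time on, and then the next label in the interval from \<open>\<gamma>\<close> to the rank of \<open>p\<close> removes it.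
\<close>
lemma cone_decomposition:
  assumes cone: "cone p C"
    and labels: "\<And>\<gamma>. \<gamma> < rk p \<Longrightarrow> infinite {k :: nat. \<gamma> \<le> a k \<and> a k < rk p}"
  shows "\<exists>D. (\<forall>k. a k < rk p \<longrightarrow> (\<exists>e. cone e (D k) \<and> rk e = a k)) \<and>
    (\<forall>j k. j \<noteq> k \<longrightarrow> D j \<inter> D k = {}) \<and> C - {p} = (\<Union>k\<in>{k. a k < rk p}. D k)"
proof -
  define idx where "idx = to_nat_on (topspace X)"
  have idx_inj: "x = y" if "idx x = idx y" "x \<in> topspace X" "y \<in> topspace X" for x y
    using inj_on_to_nat_on[OF countable] that unfolding idx_def inj_on_def by blast
  \<comment> \<open>\<open>R\<close> is what remains before the cut number \<open>n\<close>, \<open>R'\<close> what remains after it.\<close>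
  define step where "step n R R' \<longleftrightarrow> R' \<subseteq> R \<and>
    (if a n < rk p
     then (\<exists>e. cone e (R - R') \<and> rk e = a n) \<and>
       (\<forall>x\<in>R - {p}. (\<forall>y\<in>R - {p}. idx x \<le> idx y) \<and> rk x \<le> a n \<longrightarrow> x \<notin> R')
     else R' = R)" for n R R'
  have step_exists: "\<exists>R'. cone p R' \<and> step n R R'" if R: "cone p R" for n R
  proof (cases "a n < rk p")
    case True
    have R_open: "openin X R" and "p \<in> R"
      using R by (auto simp: cone_def)
    then obtain e where "e \<in> R" "rk e = a n"
      using rank_attained[OF _ _ True] by blast
    then have "R - {p} \<noteq> {}"
      using True by auto
    then obtain z where z: "z \<in> R - {p}" "\<forall>y\<in>R - {p}. idx z \<le> idx y"
      using arg_min_natI[of "\<lambda>y. y \<in> R - {p}" _ idx] arg_min_nat_le[of "\<lambda>y. y \<in> R - {p}" _ idx]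
      by (metis ex_in_conv)
    obtain e D where D: "cone e D" "rk e = a n" "D \<subseteq> R - {p}" "rk z \<le> a n \<Longrightarrow> z \<in> D"
      using peel_cone[OF R True z(1)] by blast
    have "x = z" if "x \<in> R - {p}" "\<forall>y\<in>R - {p}. idx x \<le> idx y" for x
    proof (rule idx_inj)
      show "idx x = idx z"
        using that z by (meson order_antisym)
      show "x \<in> topspace X" "z \<in> topspace X"
        using that z openin_subset[OF R_open] by auto
    qed
    moreover have "cone p (R - D)"
      using R D(1,3) by (auto simp: cone_def intro: openin_diff closedin_diff)
    moreover have "R - (R - D) = D"
      using D(3) by blast
    ultimately have "cone p (R - D) \<and> step n R (R - D)"
      unfolding step_def using True D by auto
    then show ?thesis ..
  next
    case False
    then show ?thesis
      using R by (auto simp: step_def)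
  qed
  have "\<exists>R. \<forall>n. (cone p (R n) \<and> (n = 0 \<longrightarrow> R n = C)) \<and> step n (R n) (R (Suc n))"
    by (rule dependent_nat_choice) (use cone step_exists in auto)
  then obtain R where
    R: "\<And>n. cone p (R n) \<and> (n = 0 \<longrightarrow> R n = C)" "\<And>n. step n (R n) (R (Suc n))"
    by blast
  have R0: "R 0 = C"
    using R(1)[of 0] by simp
  have anti: "R k \<subseteq> R j" if "j \<le> k" for j k
  proof (rule lift_Suc_antimono_le[OF _ that])
    show "R (Suc n) \<subseteq> R n" for n
      using R(2)[of n] by (simp add: step_def)
  qed
  have R_top: "R n \<subseteq> topspace X" "p \<in> R n" for n
    using R(1)[of n] openin_subset[of X "R n"] unfolding cone_def by blast+
  define D where "D k = R k - R (Suc k)" for k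
  have cones: "\<exists>e. cone e (D k) \<and> rk e = a k" if "a k < rk p" for k
    using R(2)[of k] that by (simp add: D_def step_def)
  have disj': "D j \<inter> D k = {}" if "j < k" for j k
    using anti[of "Suc j" k] that by (auto simp: D_def)
  have disj: "D j \<inter> D k = {}" if "j \<noteq> k" for j k
    using disj'[of j k] disj'[of k j] that by (cases j k rule: linorder_cases) auto
  have exhaust: "\<exists>k. \<forall>y\<in>R k - {p}. n \<le> idx y" for n
  proof (induction n)
    case (Suc n)
    then obtain k where k: "\<forall>y\<in>R k - {p}. n \<le> idx y" by blast
    show ?case
    proof (cases "\<exists>x\<in>R k - {p}. idx x = n")
      case True
      then obtain x where x: "x \<in> R k - {p}" "idx x = n" by blast
      then have "rk x < rk p"
        using R(1)[of k] by (simp add: cone_def)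
      then have "infinite {k. rk x \<le> a k \<and> a k < rk p}"
        by (rule labels)
      then obtain m where m: "k \<le> m" "rk x \<le> a m" "a m < rk p"
        unfolding infinite_nat_iff_unbounded_le by blast
      have "x \<notin> R (Suc m)"
      proof
        assume "x \<in> R (Suc m)"
        then have "x \<in> R m - {p}"
          using anti[of m "Suc m"] x(1) by auto
        moreover have "\<forall>y\<in>R m - {p}. idx x \<le> idx y"
          using anti[OF m(1)] k x(2) by auto
        ultimately show False
          using R(2)[of m] m(2,3) \<open>x \<in> R (Suc m)\<close> unfolding step_def by auto
      qed
      moreover have "n \<le> idx y" if "y \<in> R (Suc m) - {p}" for y
        using anti[of k "Suc m"] m(1) k that by auto
      moreover have "y = x" if "y \<in> R (Suc m)" "idx y = n" for y
        using idx_inj[of y x] that x R_top by auto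
      ultimately show ?thesis
        by (metis Diff_iff Suc_leI order_le_less)
    next
      case False
      then show ?thesis
        using k by (metis Suc_leI order_le_less)
    qed
  qed simp
  have "C - {p} = (\<Union>k\<in>{k. a k < rk p}. D k)"
  proof (intro equalityI subsetI)
    fix x assume x: "x \<in> C - {p}"
    obtain k where "x \<notin> R k"
      using exhaust[of "Suc (idx x)"] x by (metis DiffD2 DiffI not_less_eq_eq order_refl)
    then have "\<exists>j. x \<in> R j \<and> x \<notin> R (Suc j)"
      using x R0 by (induction k) auto
    then obtain j where "x \<in> D j"
      by (auto simp: D_def)
    moreover from this have "a j < rk p"
      using R(2)[of j] by (auto simp: D_def step_def split: if_splits)
    ultimately show "x \<in> (\<Union>k\<in>{k. a k < rk p}. D k)"
      by blast
  next
    fix x assume "x \<in> (\<Union>k\<in>{k. a k < rk p}. D k)"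
    then show "x \<in> C - {p}"
      using anti[of 0] R0 R_top by (auto simp: D_def)
  qed
  with cones disj show ?thesis
    by (intro exI[of _ D]) simp
qed

end

section \<open>Assembling subsets of the real line\<close>

text \<open>
  The block \<open>shrink k ` {0..1}\<close> is the interval from \<open>3 / 4 ^ (k + 1)\<close> to \<open>4 / 4 ^ (k + 1)\<close>. The gap below
  a block is at least half the distance of its far end from \<open>0\<close>. Therefore different blocks can be
  treated independently, at the cost of a factor \<open>2\<close> in Lipschitz constants, and the factor
  \<open>1 / 4\<close> of \<open>shrink 0\<close> more than compensates for that.
\<close>
definition shrink :: "nat \<Rightarrow> real \<Rightarrow> real"
  where "shrink k x = (3 + x) / 4 ^ Suc k"

lemma homeomorphic_of_continuous_injection:
  fixes h :: "'a \<Rightarrow> real"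
  assumes "compact_space X" "closedin X C" "openin X C"
    and "\<And>V. open V \<Longrightarrow> openin X {x \<in> C. h x \<in> V}" "inj_on h C" "h ` C = S"
  shows "subtopology X C homeomorphic_space top_of_set S"
proof -
  have C: "C \<subseteq> topspace X"
    using assms(2) closedin_subset by blast
  have "continuous_map (subtopology X C) euclideanreal h"
    unfolding continuous_map_def topspace_subtopology_subset[OF C]
      openin_open_subtopology[OF assms(3)] using assms(4) by auto
  then have "continuous_map (subtopology X C) (top_of_set S) h"
    using assms(6) C by (auto simp: continuous_map_in_subtopology)
  then have "homeomorphic_map (subtopology X C) (top_of_set S) h"
    using assms(1,2,5,6) C
    by (intro continuous_imp_homeomorphic_map)
      (simp_all add: closedin_compact_space compact_space_subtopology inf_absorb2
        Hausdorff_space_subtopology)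
  then show ?thesis
    using homeomorphic_space by blast
qed

lemma continuous_injection_of_homeomorphic:
  assumes "openin X C" "subtopology X C homeomorphic_space top_of_set (S :: real set)"
  shows "\<exists>h. (\<forall>V. open V \<longrightarrow> openin X {x \<in> C. h x \<in> V}) \<and> inj_on h C \<and> h ` C = S"
proof -
  have C: "topspace (subtopology X C) = C"
    using openin_subset[OF assms(1)] by (rule topspace_subtopology_subset)
  obtain h where h: "homeomorphic_map (subtopology X C) (top_of_set S) h"
    using assms(2) homeomorphic_space by blast
  have "continuous_map (subtopology X C) euclideanreal h"
    using homeomorphic_imp_continuous_map[OF h] by (simp add: continuous_map_in_subtopology)
  then have "openin X {x \<in> C. h x \<in> V}" if "open V" for V
    using that assms(1) unfolding continuous_map_def C openin_open_subtopology[OF assms(1)]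
    by simp
  then show ?thesis
    using homeomorphic_imp_injective_map[OF h] homeomorphic_imp_surjective_map[OF h] C by auto
qed

lemma shrink_bounds:
  assumes "0 \<le> x" "x \<le> 1"
  shows "3 / 4 ^ Suc k \<le> shrink k x" "shrink k x \<le> 4 / 4 ^ Suc k"
  using assms by (auto simp: shrink_def divide_simps)

lemma shrink_gap:
  assumes "0 \<le> x" "x \<le> 1" "0 \<le> y" "y \<le> 1" "j < k"
  shows "2 / 4 ^ Suc j \<le> shrink j x - shrink k y"
proof -
  have "(4::real) ^ Suc (Suc j) \<le> 4 ^ Suc k"
    using assms(5) by (intro power_increasing) auto
  then have "4 / 4 ^ Suc k \<le> 1 / (4::real) ^ Suc j"
    by (simp add: divide_simps)
  then show ?thesis
    using shrink_bounds(1)[OF assms(1,2), of j] shrink_bounds(2)[OF assms(3,4), of k]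
    by simp
qed

lemma inj_shrink: "shrink k x = shrink k y \<longleftrightarrow> x = y"
  by (simp add: shrink_def)

text \<open>
  Only continuity at \<open>p\<close> needs an argument: the complement in \<open>C\<close> of the first \<open>n\<close> pieces is a
  neighbourhood of \<open>p\<close>, and it is mapped into the interval from \<open>0\<close> to \<open>1 / 4 ^ n\<close>.
\<close>
lemma glue_null_sequence:
  fixes S :: "nat \<Rightarrow> real set"
  assumes X: "compact_space X" and C: "openin X C" "closedin X C" "p \<in> C"
    and D: "\<And>k. k \<in> I \<Longrightarrow> openin X (D k) \<and> closedin X (D k)"
    and disj: "\<And>j k. j \<noteq> k \<Longrightarrow> D j \<inter> D k = {}"
    and cover: "C - {p} = (\<Union>k\<in>I. D k)"
    and S: "\<And>k. k \<in> I \<Longrightarrow> subtopology X (D k) homeomorphic_space top_of_set (S k)"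
      "\<And>k. k \<in> I \<Longrightarrow> S k \<subseteq> {0..1}"
  shows "subtopology X C homeomorphic_space top_of_set (insert 0 (\<Union>k\<in>I. shrink k ` S k))"
proof -
  have "\<exists>h. (\<forall>V. open V \<longrightarrow> openin X {x \<in> D k. h x \<in> V}) \<and> inj_on h (D k) \<and> h ` D k = S k"
    if "k \<in> I" for k
    using that D S(1) by (intro continuous_injection_of_homeomorphic) auto
  then obtain h where h: "\<And>k V. \<lbrakk>k \<in> I; open V\<rbrakk> \<Longrightarrow> openin X {x \<in> D k. h k x \<in> V}"
    "\<And>k. k \<in> I \<Longrightarrow> inj_on (h k) (D k)" "\<And>k. k \<in> I \<Longrightarrow> h k ` D k = S k"
    by metis
  have D_sub: "D k \<subseteq> C - {p}" if "k \<in> I" for k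
    using that unfolding cover by blast
  define g where "g x = (if x = p then 0 else
    (let k = (THE k. x \<in> D k) in shrink k (h k x)))" for x
  have g_p: "g p = 0"
    by (simp add: g_def)
  have the: "(THE k. x \<in> D k) = k" if "x \<in> D k" for x k
  proof (rule the_equality[of "\<lambda>k. x \<in> D k", OF that])
    fix j assume "x \<in> D j"
    then show "j = k"
      using disj[of j k] that by blast
  qed
  have g_D: "g x = shrink k (h k x)" "0 \<le> h k x" "h k x \<le> 1" "x \<noteq> p" if "k \<in> I" "x \<in> D k" for x k
  proof -
    show "x \<noteq> p"
      using that D_sub by blast
    then show "g x = shrink k (h k x)"
      by (simp add: g_def the[OF that(2)] Let_def)
    have "h k x \<in> S k"
      using h(3)[OF that(1)] that(2) by blast
    then show "0 \<le> h k x" "h k x \<le> 1"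
      using S(2)[OF that(1)] by auto
  qed
  have g_pos: "0 < g x" if x: "x \<in> C - {p}" for x
  proof -
    obtain k where k: "k \<in> I" "x \<in> D k"
      using x unfolding cover by blast
    have "0 < 3 / (4::real) ^ Suc k"
      by simp
    then show ?thesis
      using shrink_bounds(1)[OF g_D(2,3)[OF k], of k] g_D(1)[OF k] by linarith
  qed
  show ?thesis
  proof (rule homeomorphic_of_continuous_injection[OF X C(2,1)])
    show "inj_on g C"
    proof (rule inj_onI)
      fix x y assume xy: "x \<in> C" "y \<in> C" "g x = g y"
      show "x = y"
      proof (cases "x = p \<or> y = p")
        case True
        then show ?thesis
          using g_pos[of x] g_pos[of y] xy g_p by fastforce
      next
        case False
        then have "x \<in> C - {p}" "y \<in> C - {p}"
          using xy by auto
        then obtain j k where jk: "j \<in> I" "x \<in> D j" "k \<in> I" "y \<in> D k"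
          unfolding cover by blast
        have "g x \<noteq> g y" if "j < k"
          using shrink_gap[OF g_D(2,3)[OF jk(1,2)] g_D(2,3)[OF jk(3,4)] that]
            g_D(1)[OF jk(1,2)] g_D(1)[OF jk(3,4)] zero_less_power[of "4 :: real" "Suc j"]
          by (smt (verit) divide_pos_pos)
        moreover have "g x \<noteq> g y" if "k < j"
          using shrink_gap[OF g_D(2,3)[OF jk(3,4)] g_D(2,3)[OF jk(1,2)] that]
            g_D(1)[OF jk(1,2)] g_D(1)[OF jk(3,4)] zero_less_power[of "4 :: real" "Suc k"]
          by (smt (verit) divide_pos_pos)
        ultimately have "j = k"
          using xy(3) by (meson linorder_neqE_nat)
        then show ?thesis
          using jk xy(3) g_D(1)[OF jk(1,2)] g_D(1)[OF jk(3,4)] h(2)[OF jk(1)]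
          by (simp add: inj_shrink inj_on_def)
      qed
    qed
    have "g ` (C - {p}) = (\<Union>k\<in>I. g ` D k)"
      unfolding cover by blast
    also have "\<dots> = (\<Union>k\<in>I. shrink k ` S k)"
    proof (rule SUP_cong[OF refl])
      fix k assume k: "k \<in> I"
      have "g ` D k = shrink k ` h k ` D k"
        unfolding image_image using g_D(1)[OF k] by (rule image_cong[OF refl])
      then show "g ` D k = shrink k ` S k"
        by (simp add: h(3)[OF k])
    qed
    finally show "g ` C = insert 0 (\<Union>k\<in>I. shrink k ` S k)"
      using C(3) g_p by (metis image_insert insert_Diff)
  next
    fix V :: "real set"
    assume V: "open V"
    have in_D: "\<exists>U. openin X U \<and> x \<in> U \<and> U \<subseteq> {x \<in> C. g x \<in> V}"
      if x: "x \<in> C" "g x \<in> V" "x \<noteq> p" for x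
    proof -
      have "x \<in> C - {p}"
        using x by blast
      then obtain k where k: "k \<in> I" "x \<in> D k"
        unfolding cover by blast
      have "open (shrink k -` V)"
        using V by (intro open_vimage) (auto simp: shrink_def intro!: continuous_intros)
      then have "openin X {y \<in> D k. h k y \<in> shrink k -` V}"
        using h(1)[OF k(1)] by blast
      moreover have "{y \<in> D k. h k y \<in> shrink k -` V} \<subseteq> {y \<in> C. g y \<in> V}"
        using g_D(1)[OF k(1)] D_sub[OF k(1)] by fastforce
      moreover have "x \<in> {y \<in> D k. h k y \<in> shrink k -` V}"
        using k(2) x(2) g_D(1)[OF k] by simp
      ultimately show ?thesis
        by blast
    qed
    have at_p: "\<exists>U. openin X U \<and> p \<in> U \<and> U \<subseteq> {x \<in> C. g x \<in> V}" if zero: "0 \<in> V"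
    proof -
      obtain \<epsilon> where \<epsilon>: "\<epsilon> > 0" "ball 0 \<epsilon> \<subseteq> V"
        using openE[OF V zero] by blast
      obtain n where n: "(1 / 4 :: real) ^ n < \<epsilon>"
        using real_arch_pow_inv[of \<epsilon> "1 / 4"] \<epsilon>(1) by auto
      let ?U = "C - (\<Union>k\<in>I \<inter> {..<n}. D k)"
      have "openin X ?U"
        using C D by (intro openin_diff closedin_Union) auto
      moreover have "p \<in> ?U"
        using C(3) D_sub by blast
      moreover have "g x \<in> V" if x: "x \<in> ?U" for x
      proof (cases "x = p")
        case False
        then have "x \<in> C - {p}"
          using x by blast
        then obtain k where k: "k \<in> I" "x \<in> D k"
          unfolding cover by blast
        then have "n \<le> k"
          using x by (metis DiffD2 IntI UN_I lessThan_iff not_less)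
        have "g x \<le> 4 / 4 ^ Suc k"
          using shrink_bounds(2)[OF g_D(2,3)[OF k]] g_D(1)[OF k] by simp
        also have "\<dots> = (1 / 4) ^ k"
          by (simp add: field_simps)
        also have "\<dots> \<le> (1 / 4) ^ n"
          using \<open>n \<le> k\<close> by (intro power_decreasing) auto
        finally have "\<bar>g x\<bar> < \<epsilon>"
          using n g_pos[of x] x False by auto
        then show ?thesis
          using \<epsilon>(2) by (auto simp: subset_eq)
      qed (use zero g_p in simp)
      ultimately show ?thesis
        by blast
    qed
    show "openin X {x \<in> C. g x \<in> V}"
    proof (subst openin_subopen, intro ballI)
      fix x assume "x \<in> {x \<in> C. g x \<in> V}"
      then show "\<exists>U. openin X U \<and> x \<in> U \<and> U \<subseteq> {x \<in> C. g x \<in> V}"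
        using in_D[of x] at_p g_p by (cases "x = p") auto
    qed
  qed
qed

lemma glue_finitely_many:
  fixes S :: "nat \<Rightarrow> real set"
  assumes X: "compact_space X"
    and D: "\<And>k. k < n \<Longrightarrow> openin X (D k) \<and> closedin X (D k)"
    and disj: "\<And>j k. \<lbrakk>j < n; k < n; j \<noteq> k\<rbrakk> \<Longrightarrow> D j \<inter> D k = {}"
    and cover: "topspace X = (\<Union>k<n. D k)"
    and S: "\<And>k. k < n \<Longrightarrow> subtopology X (D k) homeomorphic_space top_of_set (S k)"
      "\<And>k. k < n \<Longrightarrow> S k \<subseteq> {0..1}"
  shows "X homeomorphic_space top_of_set (\<Union>k<n. (\<lambda>x. x + 2 * real k) ` S k)"
proof -
  have "\<exists>h. (\<forall>V. open V \<longrightarrow> openin X {x \<in> D k. h x \<in> V}) \<and> inj_on h (D k) \<and> h ` D k = S k"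
    if "k < n" for k
    using that D S(1) by (intro continuous_injection_of_homeomorphic) auto
  then obtain h where h: "\<And>k V. \<lbrakk>k < n; open V\<rbrakk> \<Longrightarrow> openin X {x \<in> D k. h k x \<in> V}"
    "\<And>k. k < n \<Longrightarrow> inj_on (h k) (D k)" "\<And>k. k < n \<Longrightarrow> h k ` D k = S k"
    by metis
  define g where "g x = (let k = (THE k. k < n \<and> x \<in> D k) in h k x + 2 * real k)" for x
  have g_D: "g x = h k x + 2 * real k" "0 \<le> h k x" "h k x \<le> 1" if "k < n" "x \<in> D k" for x k
  proof -
    have "(THE k. k < n \<and> x \<in> D k) = k"
    proof (rule the_equality)
      fix j assume "j < n \<and> x \<in> D j"
      then show "j = k"
        using disj[of j k] that by blast
    qed (use that in blast)
    then show "g x = h k x + 2 * real k"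
      by (simp add: g_def Let_def)
    have "h k x \<in> S k"
      using h(3)[OF that(1)] that(2) by blast
    then show "0 \<le> h k x" "h k x \<le> 1"
      using S(2)[OF that(1)] by auto
  qed
  have "subtopology X (topspace X) homeomorphic_space
    top_of_set (\<Union>k<n. (\<lambda>x. x + 2 * real k) ` S k)"
  proof (rule homeomorphic_of_continuous_injection[OF X])
    show "inj_on g (topspace X)"
    proof (rule inj_onI)
      fix x y assume xy: "x \<in> topspace X" "y \<in> topspace X" "g x = g y"
      then obtain j k where jk: "j < n" "x \<in> D j" "k < n" "y \<in> D k"
        using cover by blast
      have "real j < real k + 1" "real k < real j + 1"
        using g_D[OF jk(1,2)] g_D[OF jk(3,4)] xy(3) by auto
      then have "j = k"
        by linarith
      then show "x = y"
        using jk xy(3) g_D(1)[OF jk(1,2)] g_D(1)[OF jk(3,4)] h(2)[OF jk(1)]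
        by (simp add: inj_on_def)
    qed
    have "g ` topspace X = (\<Union>k<n. g ` D k)"
      unfolding cover by blast
    also have "\<dots> = (\<Union>k<n. (\<lambda>x. x + 2 * real k) ` S k)"
    proof (rule SUP_cong[OF refl])
      fix k assume k: "k \<in> {..<n}"
      have "g ` D k = (\<lambda>x. x + 2 * real k) ` h k ` D k"
        unfolding image_image using g_D(1) k by (intro image_cong[OF refl]) auto
      then show "g ` D k = (\<lambda>x. x + 2 * real k) ` S k"
        using h(3) k by simp
    qed
    finally show "g ` topspace X = (\<Union>k<n. (\<lambda>x. x + 2 * real k) ` S k)" .
  next
    fix V :: "real set"
    assume V: "open V"
    have "{x \<in> topspace X. g x \<in> V} = (\<Union>k<n. {x \<in> D k. h k x \<in> (\<lambda>x. x + 2 * real k) -` V})"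
      unfolding cover using g_D(1) by auto
    moreover have "openin X {x \<in> D k. h k x \<in> (\<lambda>x. x + 2 * real k) -` V}" if "k < n" for k
      using V that by (intro h(1) open_vimage) (auto intro!: continuous_intros)
    ultimately show "openin X {x \<in> topspace X. g x \<in> V}"
      by auto
  qed auto
  then show ?thesis
    by simp
qed

section \<open>The set of decreasing words\<close>

text \<open>
  The points \<open>shrink k\<^sub>1 (\<dots> (shrink k\<^sub>d 0))\<close> for the words with \<open>\<beta> > a k\<^sub>1 > \<dots> > a k\<^sub>d\<close>.
\<close>
inductive decreasing_point :: "(nat \<Rightarrow> 'o::wellorder) \<Rightarrow> 'o \<Rightarrow> real \<Rightarrow> bool" for a where
  zero: "decreasing_point a \<beta> 0"
| shrink: "\<lbrakk>a k < \<beta>; decreasing_point a (a k) x\<rbrakk> \<Longrightarrow> decreasing_point a \<beta> (shrink k x)"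

definition model :: "(nat \<Rightarrow> 'o::wellorder) \<Rightarrow> 'o \<Rightarrow> real set"
  where "model a \<beta> = Collect (decreasing_point a \<beta>)"

lemma model_unfold: "model a \<beta> = insert 0 (\<Union>k\<in>{k. a k < \<beta>}. shrink k ` model a (a k))"
proof -
  have "x \<in> model a \<beta> \<longleftrightarrow> x = 0 \<or> (\<exists>k. a k < \<beta> \<and> (\<exists>y\<in>model a (a k). x = shrink k y))" for x
    unfolding model_def mem_Collect_eq Bex_def by (subst decreasing_point.simps) blast
  then show ?thesis
    by blast
qed

lemma model_subset: "model a \<beta> \<subseteq> {0..1}"
proof -
  have "0 \<le> x \<and> x \<le> 1" if "decreasing_point a \<beta> x" for x
    using that
  proof induction
    case (shrink k \<beta> x)
    have "(4::real) \<le> 4 ^ Suc k"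
      by simp
    then show ?case
      using shrink_bounds[of x k] shrink
      by (smt (verit) divide_le_eq_1 divide_nonneg_nonneg)
  qed auto
  then show ?thesis
    by (auto simp: model_def)
qed

context ranked_space
begin

text \<open>
  The decomposition of a cone by labels below its rank has exactly the recursive structure of the
  model.
\<close>
lemma cone_homeomorphic_model:
  assumes labels: "\<And>\<gamma>. \<gamma> < \<delta> \<Longrightarrow> infinite {k. a k = \<gamma>}"
    and "cone p C" "rk p \<le> \<delta>"
  shows "subtopology X C homeomorphic_space top_of_set (model a (rk p))"
  using assms(2,3)
proof (induction "rk p" arbitrary: p C rule: less_induct)
  case less
  have inf: "infinite {k. \<gamma> \<le> a k \<and> a k < rk p}" if "\<gamma> < rk p" for \<gamma>
  proof -
    have "infinite {k. a k = \<gamma>}"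
      using labels that less.prems(2) by auto
    moreover have "{k. a k = \<gamma>} \<subseteq> {k. \<gamma> \<le> a k \<and> a k < rk p}"
      using that by auto
    ultimately show ?thesis
      using infinite_super by blast
  qed
  obtain D where De: "\<And>k. a k < rk p \<Longrightarrow> \<exists>e. cone e (D k) \<and> rk e = a k"
    and disj: "\<And>j k. j \<noteq> k \<Longrightarrow> D j \<inter> D k = {}"
    and cover: "C - {p} = (\<Union>k\<in>{k. a k < rk p}. D k)"
    using cone_decomposition[where a = a, OF less.prems(1) inf] by metis
  show ?case
    unfolding model_unfold[of a "rk p"]
  proof (rule glue_null_sequence[OF compact _ _ _ _ disj cover])
    show "openin X C" "closedin X C" "p \<in> C"
      using less.prems(1) by (auto simp: cone_def)
  next
    fix k assume "k \<in> {k. a k < rk p}"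
    then have k: "a k < rk p"
      by simp
    obtain e where e: "cone e (D k)" "rk e = a k"
      using De[OF k] by blast
    show "openin X (D k) \<and> closedin X (D k)"
      using e(1) by (simp add: cone_def)
    show "subtopology X (D k) homeomorphic_space top_of_set (model a (a k))"
      using less.hyps[of e "D k"] e k less.prems(2) by auto
  qed (simp_all add: model_subset)
qed

text \<open>
  Below the successor of \<open>\<delta>\<close> the constant label \<open>\<delta>\<close> is admissible. All blocks of the resulting set are
  scaled copies of the same set, so that \<open>x \<mapsto> x / 4\<close> shifts them; blocks of different ranks, as in
  \<^const>\<open>model\<close>, would not allow this.
\<close>
lemma cone_homeomorphic_successor_model:
  assumes labels: "\<And>\<gamma>. \<gamma> < \<delta> \<Longrightarrow> infinite {k. a k = \<gamma>}"
    and "cone p C" "\<delta> < rk p" "\<And>\<gamma>. \<gamma> < rk p \<Longrightarrow> \<gamma> \<le> \<delta>"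
  shows "subtopology X C homeomorphic_space
    top_of_set (insert 0 (\<Union>k. shrink k ` model a \<delta>))"
proof -
  have inf: "infinite {k :: nat. \<gamma> \<le> \<delta> \<and> \<delta> < rk p}" if "\<gamma> < rk p" for \<gamma>
  proof -
    have "{k :: nat. \<gamma> \<le> \<delta> \<and> \<delta> < rk p} = UNIV"
      using assms(3) assms(4)[OF that] by blast
    then show ?thesis
      by simp
  qed
  obtain D where De: "\<And>k :: nat. \<exists>e. cone e (D k) \<and> rk e = \<delta>"
    and disj: "\<And>j k. j \<noteq> k \<Longrightarrow> D j \<inter> D k = {}"
    and cover: "C - {p} = (\<Union>k\<in>UNIV. D k)"
    using cone_decomposition[where a = "\<lambda>k. \<delta>", OF assms(2) inf] assms(3) by (simp) blast
  show ?thesis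
  proof (rule glue_null_sequence[OF compact _ _ _ _ disj cover])
    show "openin X C" "closedin X C" "p \<in> C"
      using assms(2) by (auto simp: cone_def)
  next
    fix k :: nat
    obtain e where e: "cone e (D k)" "rk e = \<delta>"
      using De by blast
    show "openin X (D k) \<and> closedin X (D k)"
      using e(1) by (simp add: cone_def)
    show "subtopology X (D k) homeomorphic_space top_of_set (model a \<delta>)"
      using cone_homeomorphic_model[OF labels e(1)] e(2) by simp
  qed (simp_all add: model_subset)
qed

end

section \<open>The successor model is an attractor\<close>

lemma shrink_eq_iff:
  assumes "0 \<le> x" "x \<le> 1" "0 \<le> y" "y \<le> 1"
  shows "shrink j x = shrink k y \<longleftrightarrow> j = k \<and> x = y"
proof -
  have pos: "0 < 2 / (4::real) ^ Suc i" for i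
    by simp
  have "shrink j x \<noteq> shrink k y" if "j < k"
    using shrink_gap[OF assms that] pos[of j] by linarith
  moreover have "shrink j x \<noteq> shrink k y" if "k < j"
    using shrink_gap[OF assms(3,4,1,2) that] pos[of k] by linarith
  ultimately show ?thesis
    by (metis inj_shrink linorder_neqE_nat)
qed

lemma shrink_pos: "0 \<le> x \<Longrightarrow> 0 < shrink k x"
  by (simp add: shrink_def)

lemma shrink_in_model_iff:
  assumes "x \<in> model a (a k)"
  shows "shrink k x \<in> model a \<beta> \<longleftrightarrow> a k < \<beta>"
proof
  assume "a k < \<beta>"
  then show "shrink k x \<in> model a \<beta>"
    using assms by (auto simp: model_def intro: decreasing_point.shrink)
next
  have x: "0 \<le> x" "x \<le> 1"
    using assms model_subset by fastforce+
  assume "shrink k x \<in> model a \<beta>"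
  then consider "shrink k x = 0" | j y where "a j < \<beta>" "y \<in> model a (a j)" "shrink k x = shrink j y"
    unfolding model_unfold[of a \<beta>] by blast
  then show "a k < \<beta>"
  proof cases
    case 1
    then show ?thesis
      using shrink_pos[OF x(1), of k] by simp
  next
    case 2
    then have "0 \<le> y" "y \<le> 1"
      using model_subset by fastforce+
    then show ?thesis
      using 2 shrink_eq_iff[OF x] by metis
  qed
qed

lemma model_mono:
  assumes "\<beta> \<le> \<gamma>"
  shows "model a \<beta> \<subseteq> model a \<gamma>"
  unfolding model_unfold[of a \<beta>] model_unfold[of a \<gamma>] using assms by (auto intro: less_le_trans)

lemma zero_in_model: "0 \<in> model a \<beta>"
  by (simp add: model_def decreasing_point.zero)

text \<open>
  Let \<open>j\<close> be the index of the upper one of two different blocks. Points of these blocks are at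
  least \<open>2 / 4 ^ (j + 1)\<close> apart, whereas both their values lie between \<open>0\<close> and \<open>4 / 4 ^ (j + 1)\<close>.
\<close>
lemma lipschitz_of_blocks:
  fixes F :: "real \<Rightarrow> real"
  assumes A: "\<And>k. k \<in> I \<Longrightarrow> A k \<subseteq> {0..1}"
    and zero: "F 0 = 0"
    and range: "\<And>k x. \<lbrakk>k \<in> I; x \<in> A k\<rbrakk> \<Longrightarrow> 0 \<le> F (shrink k x) \<and> F (shrink k x) \<le> 4 / 4 ^ Suc k"
    and block: "\<And>k x y. \<lbrakk>k \<in> I; x \<in> A k; y \<in> A k\<rbrakk> \<Longrightarrow>
      \<bar>F (shrink k x) - F (shrink k y)\<bar> \<le> 2 * \<bar>shrink k x - shrink k y\<bar>"
    and S: "S = insert 0 (\<Union>k\<in>I. shrink k ` A k)"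
    and xy: "x \<in> S" "y \<in> S"
  shows "\<bar>F x - F y\<bar> \<le> 2 * \<bar>x - y\<bar>"
proof -
  have vs_zero: "\<bar>F z - F 0\<bar> \<le> 2 * \<bar>z - 0\<bar>" if z: "z \<in> S" for z
  proof (cases "z = 0")
    case False
    then obtain k u where ku: "k \<in> I" "u \<in> A k" "z = shrink k u"
      using z unfolding S by blast
    then have "0 \<le> u" "u \<le> 1"
      using A by fastforce+
    moreover define \<epsilon> where "\<epsilon> = 1 / (4::real) ^ Suc k"
    ultimately have "3 * \<epsilon> \<le> z"
      using shrink_bounds(1)[of u k] ku(3) by simp
    moreover have "0 < \<epsilon>" "0 \<le> F z" "F z \<le> 4 * \<epsilon>"
      using range[OF ku(1,2)] ku(3) by (auto simp: \<epsilon>_def)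
    ultimately show ?thesis
      unfolding zero by simp
  qed simp
  have cross: "\<bar>F (shrink j u) - F (shrink k v)\<bar> \<le> 2 * \<bar>shrink j u - shrink k v\<bar>"
    if j: "j \<in> I" "u \<in> A j" and k: "k \<in> I" "v \<in> A k" and less: "j < k" for j k u v
  proof -
    have uv: "0 \<le> u" "u \<le> 1" "0 \<le> v" "v \<le> 1"
      using A j k by fastforce+
    define \<epsilon> where "\<epsilon> = 1 / (4::real) ^ Suc j"
    have "1 / (4::real) ^ Suc k \<le> \<epsilon>"
      unfolding \<epsilon>_def using less by (intro divide_left_mono power_increasing) auto
    then have "F (shrink k v) \<le> 4 * \<epsilon>" "F (shrink j u) \<le> 4 * \<epsilon>"
      using range[OF j] range[OF k] by (auto simp: \<epsilon>_def)
    moreover have "2 * \<epsilon> \<le> shrink j u - shrink k v"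
      using shrink_gap[OF uv less] by (simp add: \<epsilon>_def)
    moreover have "0 \<le> F (shrink k v)" "0 \<le> F (shrink j u)"
      using range[OF j] range[OF k] by auto
    ultimately have "\<bar>F (shrink j u) - F (shrink k v)\<bar> \<le> 4 * \<epsilon>"
      "4 * \<epsilon> \<le> 2 * \<bar>shrink j u - shrink k v\<bar>"
      by auto
    then show ?thesis
      by (rule order_trans)
  qed
  show ?thesis
  proof (cases "x = 0 \<or> y = 0")
    case True
    then show ?thesis
      using vs_zero[OF xy(1)] vs_zero[OF xy(2)] by auto
  next
    case False
    then obtain j u k v where "j \<in> I" "u \<in> A j" "x = shrink j u" "k \<in> I" "v \<in> A k" "y = shrink k v"
      using xy unfolding S by blast
    then show ?thesis
      using cross[of j u k v] cross[of k v j u] block[of j u v]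
      by (cases j k rule: linorder_cases) (simp_all add: abs_minus_commute)
  qed
qed

text \<open>
  The value \<open>0\<close> off \<open>S\<close> represents the empty word, the apex of every model.
\<close>
definition retract :: "real set \<Rightarrow> real \<Rightarrow> real"
  where "retract S x = (if x \<in> S then x else 0)"

lemma retract_model_lipschitz:
  assumes "x \<in> model a \<delta>" "y \<in> model a \<delta>"
  shows "\<bar>retract (model a \<beta>) x - retract (model a \<beta>) y\<bar> \<le> 2 * \<bar>x - y\<bar>"
proof (rule lipschitz_of_blocks[OF _ _ _ _ model_unfold assms])
  fix k x y
  assume x: "x \<in> model a (a k)" and y: "y \<in> model a (a k)"
  show "\<bar>retract (model a \<beta>) (shrink k x) - retract (model a \<beta>) (shrink k y)\<bar>
    \<le> 2 * \<bar>shrink k x - shrink k y\<bar>"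
    using shrink_in_model_iff[OF x] shrink_in_model_iff[OF y] by (simp add: retract_def)
next
  fix k x
  assume "x \<in> model a (a k)"
  then have "0 \<le> x" "x \<le> 1"
    using model_subset by fastforce+
  then show "0 \<le> retract (model a \<beta>) (shrink k x) \<and>
      retract (model a \<beta>) (shrink k x) \<le> 4 / 4 ^ Suc k"
    using shrink_bounds(2)[of x k] shrink_pos[of x k] by (simp add: retract_def)
qed (auto simp: retract_def model_subset)

text \<open>
  The uniform ratio \<open>1 / 2\<close> is what survives the passage to several translates of \<open>S\<close>.
\<close>
definition half_ifs :: "real set \<Rightarrow> (real \<Rightarrow> real) set \<Rightarrow> bool"
  where "half_ifs S F \<longleftrightarrow> finite F \<and> S = (\<Union>f\<in>F. f ` S) \<and>
    (\<forall>f\<in>F. \<forall>x\<in>S. \<forall>y\<in>S. \<bar>f x - f y\<bar> \<le> 1 / 2 * \<bar>x - y\<bar>)"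

text \<open>
  Two maps suffice: \<open>x \<mapsto> x / 4\<close> covers \<open>0\<close> and all blocks but the first, and \<open>shrink 0 \<circ> \<pi>\<close> covers the
  first one, where \<open>\<pi>\<close> truncates the address of a point to its longest prefix that is an address in
  \<open>model a \<delta>\<close>. In an address \<open>k w\<close> of \<open>Y a \<delta>\<close> the word \<open>w\<close> is decreasing, so if \<open>k w\<close> is not an address in
  \<open>model a \<delta>\<close>, then this prefix is \<open>k\<close> or empty.
\<close>
lemma successor_model_half_ifs:
  defines "Y \<equiv> \<lambda>a \<delta>. insert 0 (\<Union>k. shrink k ` model a \<delta>)"
  shows "\<exists>F. half_ifs (Y a \<delta>) F"
proof -
  define K where "K = model a \<delta>"
  have K01: "0 \<le> x" "x \<le> 1" if "x \<in> K" for x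
    using that model_subset unfolding K_def by fastforce+
  have Y: "Y a \<delta> = insert 0 (\<Union>k\<in>UNIV. shrink k ` K)"
    by (simp add: Y_def K_def)
  define collapse where
    "collapse k x = (if a k < \<delta> then shrink k (retract (model a (a k)) x) else 0)" for k x
  \<comment> \<open>The pair \<open>(k, x)\<close> is unique, because the blocks are disjoint.\<close>
  define \<pi> where "\<pi> z = (if z = 0 then 0 else
    (case (SOME (k, x). x \<in> K \<and> z = shrink k x) of (k, x) \<Rightarrow> collapse k x))" for z
  have \<pi>_zero: "\<pi> 0 = 0"
    by (simp add: \<pi>_def)
  have \<pi>_shrink: "\<pi> (shrink k x) = collapse k x" if x: "x \<in> K" for k x
  proof -
    have "(SOME (j, y). y \<in> K \<and> shrink k x = shrink j y) = (k, x)"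
      using x K01 shrink_eq_iff by (intro some_equality) (auto simp: K01)
    moreover have "shrink k x \<noteq> 0"
      using shrink_pos[of x k] K01(1)[OF x] by simp
    ultimately show ?thesis
      by (simp add: \<pi>_def)
  qed
  have retract01: "0 \<le> retract T x" "retract T x \<le> 1" if "x \<in> K" for T x
    using K01[OF that] by (auto simp: retract_def)
  have \<pi>_lipschitz: "\<bar>\<pi> x - \<pi> y\<bar> \<le> 2 * \<bar>x - y\<bar>" if "x \<in> Y a \<delta>" "y \<in> Y a \<delta>" for x y
  proof (rule lipschitz_of_blocks[where F = \<pi> and A = "\<lambda>k. K", OF _ \<pi>_zero _ _ Y that])
    show "K \<subseteq> {0..1}"
      using K01 by auto
  next
    fix k x assume x: "x \<in> K"
    show "0 \<le> \<pi> (shrink k x) \<and> \<pi> (shrink k x) \<le> 4 / 4 ^ Suc k"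
      using shrink_bounds(2)[OF retract01[OF x]] shrink_pos[OF retract01(1)[OF x]]
      by (auto simp: \<pi>_shrink[OF x] collapse_def intro: less_imp_le)
  next
    fix k x y assume x: "x \<in> K" and y: "y \<in> K"
    have scale: "\<bar>shrink k u - shrink k v\<bar> = \<bar>u - v\<bar> / 4 ^ Suc k" for u v
      by (simp add: shrink_def diff_divide_distrib[symmetric])
    have "\<bar>retract (model a (a k)) x - retract (model a (a k)) y\<bar> / 4 ^ Suc k
      \<le> 2 * \<bar>x - y\<bar> / 4 ^ Suc k"
      using x y unfolding K_def by (intro divide_right_mono retract_model_lipschitz) auto
    then show "\<bar>\<pi> (shrink k x) - \<pi> (shrink k y)\<bar> \<le> 2 * \<bar>shrink k x - shrink k y\<bar>"
      unfolding \<pi>_shrink[OF x] \<pi>_shrink[OF y] collapse_def using scale by simp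
  qed
  have \<pi>_in: "\<pi> z \<in> K" if z: "z \<in> Y a \<delta>" for z
  proof (cases "z = 0")
    case True
    then show ?thesis
      by (simp add: \<pi>_zero K_def zero_in_model)
  next
    case False
    then obtain k x where kx: "x \<in> K" "z = shrink k x"
      using z unfolding Y by blast
    have "retract (model a (a k)) x \<in> model a (a k)"
      by (simp add: retract_def zero_in_model)
    then show ?thesis
      using shrink_in_model_iff[of _ a k \<delta>] zero_in_model
      by (auto simp: kx(2) \<pi>_shrink[OF kx(1)] collapse_def K_def)
  qed
  have K_image: "K \<subseteq> \<pi> ` Y a \<delta>"
  proof
    fix z assume z: "z \<in> K"
    then consider "z = 0" | k x where "a k < \<delta>" "x \<in> model a (a k)" "z = shrink k x"
      unfolding K_def model_unfold[of a \<delta>] by blast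
    then show "z \<in> \<pi> ` Y a \<delta>"
    proof cases
      case 1
      then show ?thesis
        using \<pi>_zero by (auto simp: Y intro: image_eqI[of _ _ 0])
    next
      case 2
      then have x: "x \<in> K"
        unfolding K_def using model_mono[OF less_imp_le[OF 2(1)]] by blast
      then have "\<pi> z = z"
        using 2 by (simp add: \<pi>_shrink collapse_def retract_def)
      moreover have "z \<in> Y a \<delta>"
        using x 2(3) by (auto simp: Y)
      ultimately show ?thesis
        by (metis image_eqI)
    qed
  qed
  have quarter: "shrink k x / 4 = shrink (Suc k) x" for k x
    by (simp add: shrink_def)
  define f where "f x = x / 4" for x :: real
  define g where "g x = shrink 0 (\<pi> x)" for x
  have g: "g ` Y a \<delta> = shrink 0 ` K"
    using \<pi>_in K_image unfolding g_def by blast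
  have "f ` shrink k ` K = shrink (Suc k) ` K" for k
    by (simp add: image_image f_def quarter)
  then have "f ` Y a \<delta> = insert 0 (\<Union>k. shrink (Suc k) ` K)"
    unfolding Y by (simp add: image_UN) (simp add: f_def)
  then have "f ` Y a \<delta> \<union> g ` Y a \<delta> = insert 0 (shrink 0 ` K \<union> (\<Union>k. shrink (Suc k) ` K))"
    unfolding g by blast
  also have "\<dots> = Y a \<delta>"
    unfolding Y by (subst UNIV_nat_eq) auto
  finally have "Y a \<delta> = (\<Union>h\<in>{f, g}. h ` Y a \<delta>)"
    by simp
  moreover have "\<bar>g x - g y\<bar> \<le> 1 / 2 * \<bar>x - y\<bar>" if "x \<in> Y a \<delta>" "y \<in> Y a \<delta>" for x y
    using \<pi>_lipschitz[OF that] by (simp add: g_def shrink_def diff_divide_distrib[symmetric])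
  moreover have "\<bar>f x - f y\<bar> \<le> 1 / 2 * \<bar>x - y\<bar>" for x y
    by (simp add: f_def diff_divide_distrib[symmetric])
  ultimately have "half_ifs (Y a \<delta>) {f, g}"
    by (auto simp: half_ifs_def)
  then show ?thesis ..
qed

lemma successor_model_subset: "insert 0 (\<Union>k. shrink k ` model a \<delta>) \<subseteq> {0..1}"
proof -
  have "0 \<le> shrink k x \<and> shrink k x \<le> 1" if "x \<in> model a \<delta>" for k x
  proof -
    have x: "0 \<le> x" "x \<le> 1"
      using that model_subset by fastforce+
    have "4 / (4::real) ^ Suc k \<le> 1"
      by simp
    then show ?thesis
      using shrink_bounds(2)[OF x, of k] shrink_pos[OF x(1), of k] by linarith
  qed
  then show ?thesis
    by auto
qed

text \<open>
  Each map of \<open>S\<close> is applied in all translates at once and followed by a shift to a chosen translate.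
  Points of different translates are at least \<open>1\<close> apart, whereas their images lie in a common
  translate at distance at most \<open>1 / 2\<close>.
\<close>
lemma translates_IFS_attractor:
  fixes S :: "real set" and n :: nat
  defines "T \<equiv> \<Union>k<n. (\<lambda>x. x + 2 * real k) ` S"
  assumes F: "half_ifs S F" and S: "S \<subseteq> {0..1}" and T: "compact T"
  shows "IFS_attractor (submetric euclidean_metric T)"
proof -
  \<comment> \<open>On \<open>T\<close>, the floor of \<open>x / 2\<close> is the index of the translate that contains \<open>x\<close>.\<close>
  define m where "m k f x = f (x - 2 * of_int \<lfloor>x / 2\<rfloor>) + 2 * real k" for k :: nat and f and x :: real
  have m: "m k f (s + 2 * real j) = f s + 2 * real k" if "s \<in> S" for k f s and j :: nat
  proof -
    have "\<lfloor>(s + 2 * real j) / 2\<rfloor> = int j"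
      using that S by (intro floor_unique) (auto simp: field_simps)
    then show ?thesis
      by (simp add: m_def)
  qed
  have f_S: "f s \<in> S" if "f \<in> F" "s \<in> S" for f s
    using F that unfolding half_ifs_def by blast
  have lip: "\<bar>m k f x - m k f y\<bar> \<le> 1 / 2 * \<bar>x - y\<bar>"
    if f: "f \<in> F" and xy: "x \<in> T" "y \<in> T" for k f x y
  proof -
    obtain i s j t where x: "s \<in> S" "x = s + 2 * real i" and y: "t \<in> S" "y = t + 2 * real j"
      using xy unfolding T_def by blast
    have eq: "m k f x - m k f y = f s - f t"
      using x y by (simp add: m)
    have f: "\<bar>f s - f t\<bar> \<le> 1 / 2 * \<bar>s - t\<bar>"
      using F f x y by (auto simp: half_ifs_def)
    have st: "0 \<le> s" "s \<le> 1" "0 \<le> t" "t \<le> 1"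
      using S x y by auto
    show ?thesis
    proof (cases "i = j")
      case True
      then show ?thesis
        using eq f x y by simp
    next
      case False
      then have "real i + 1 \<le> real j \<or> real j + 1 \<le> real i"
        by linarith
      then have "1 \<le> \<bar>x - y\<bar>"
        using st x(2) y(2) by linarith
      moreover have "\<bar>s - t\<bar> \<le> 1"
        using st by linarith
      ultimately show ?thesis
        using eq f by simp
    qed
  qed
  let ?G = "(\<lambda>(k, f). m k f) ` ({..<n} \<times> F)"
  have cover: "m k f ` T = (\<lambda>x. x + 2 * real k) ` f ` S" if "k < n" for k f
    using that m unfolding T_def by (force simp: image_iff)
  have "(\<Union>g\<in>?G. g ` T) = (\<Union>k<n. \<Union>f\<in>F. m k f ` T)"
    by auto
  also have "\<dots> = (\<Union>k<n. (\<lambda>x. x + 2 * real k) ` (\<Union>f\<in>F. f ` S))"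
    using cover by (simp add: image_UN)
  also have "\<dots> = T"
    using F unfolding T_def half_ifs_def by simp
  finally have union: "T = (\<Union>g\<in>?G. g ` T)" ..
  have "contraction (submetric euclidean_metric T) g" if g: "g \<in> ?G" for g
  proof -
    have "g ` T \<subseteq> T"
      using union g by blast
    moreover obtain k f where "f \<in> F" "g = m k f"
      using g by auto
    ultimately show ?thesis
      using lip by (auto simp: contraction_def dist_real_def intro!: exI[of _ "1 / 2"])
  qed
  moreover have "compact_space (mtopology_of (submetric euclidean_metric T))"
    using T by (simp add: mtopology_of_submetric compact_space_subtopology)
  moreover have "finite ?G"
    using F by (simp add: half_ifs_def)
  ultimately show ?thesis
    unfolding IFS_attractor_def using union by (intro conjI exI[of _ ?G]) auto
qed

section \<open>The rank of a countable compact metrizable space\<close>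

text \<open>
  The distances from \<open>x\<close> take only countably many values, so the open and the closed ball around \<open>x\<close>
  agree for some arbitrarily small radii.
\<close>
lemma clopen_base_of_countable_metrizable:
  assumes "metrizable_space X" "countable (topspace X)" "openin X U" "x \<in> U"
  shows "\<exists>C. openin X C \<and> closedin X C \<and> x \<in> C \<and> C \<subseteq> U"
proof -
  obtain M d where M: "Metric_space M d" "X = Metric_space.mtopology M d"
    using assms(1) unfolding metrizable_space_def by blast
  interpret Metric_space M d
    by (rule M(1))
  have xM: "x \<in> M"
    using assms(3,4) openin_subset M(2) by fastforce
  obtain r where r: "0 < r" "mball x r \<subseteq> U"
    using assms(3,4) M(2) openin_mtopology by blast
  have "countable (d x ` M)"
    using assms(2) M(2) by simp
  then have "\<not> {0<..<r} \<subseteq> d x ` M"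
    using r(1) uncountable_open_interval[of 0 r] countable_subset by blast
  then obtain s where "s \<in> {0<..<r}" "s \<notin> d x ` M"
    by blast
  then have s: "0 < s" "s < r" "s \<notin> d x ` M"
    by auto
  have "mball x s = mcball x s"
    using s(3) by (force simp: mball_def mcball_def order_le_less)
  then have "openin X (mball x s)" "closedin X (mball x s)"
    unfolding M(2) using openin_mball[of x s] closedin_mcball[of x s] by simp_all
  moreover have "x \<in> mball x s"
    using xM s(1) by simp
  moreover have "mball x s \<subseteq> U"
    using r(2) s(2) mball_subset_concentric[of s r x] by auto
  ultimately show ?thesis
    by blast
qed

text \<open>
  The first derivative that omits \<open>x\<close> cannot have index \<open>0\<close> or a limit index; the predecessor of
  its index is the rank.
\<close>
lemma cb_rank_exists:
  assumes "Hausdorff_space X" "x \<in> topspace X"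
  shows "\<exists>\<beta>\<le>\<theta>. \<forall>\<gamma>\<le>\<theta>. x \<in> cb_derivative X \<gamma> \<longleftrightarrow> \<gamma> \<le> \<beta>"
proof (cases "x \<in> cb_derivative X \<theta>")
  case True
  then show ?thesis
    using cb_derivative_antitone[OF assms(1)] by blast
next
  case False
  define \<mu> where "\<mu> = (LEAST \<gamma>. x \<notin> cb_derivative X \<gamma>)"
  have \<mu>: "x \<notin> cb_derivative X \<mu>" "\<mu> \<le> \<theta>"
    unfolding \<mu>_def using False by (rule LeastI, rule Least_le)
  have below: "x \<in> cb_derivative X \<gamma>" if "\<gamma> < \<mu>" for \<gamma>
    using not_less_Least[of \<gamma> "\<lambda>\<gamma>. x \<notin> cb_derivative X \<gamma>"] that unfolding \<mu>_def by blast
  have "\<mu> \<noteq> 0"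
    using \<mu>(1) assms(2) by (auto simp: cb_derivative_0)
  then have "successor_ordinal \<mu>"
    using \<mu>(1) below cb_derivative_limit[of \<mu> X] by blast
  then obtain \<beta> where \<beta>: "\<beta> < \<mu>" "\<forall>\<gamma><\<mu>. \<gamma> \<le> \<beta>"
    by (auto simp: successor_ordinal_def succ_of_def)
  have "x \<in> cb_derivative X \<gamma> \<longleftrightarrow> \<gamma> \<le> \<beta>" for \<gamma>
  proof
    assume "x \<in> cb_derivative X \<gamma>"
    then have "\<not> \<mu> \<le> \<gamma>"
      using \<mu>(1) cb_derivative_antitone[OF assms(1)] by blast
    then show "\<gamma> \<le> \<beta>"
      using \<beta>(2) by simp
  next
    assume "\<gamma> \<le> \<beta>"
    then show "x \<in> cb_derivative X \<gamma>"
      using \<beta>(1) by (intro below) simp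
  qed
  moreover have "\<beta> \<le> \<theta>"
    using \<beta>(1) \<mu>(2) by simp
  ultimately show ?thesis
    by blast
qed

definition cb_rank :: "'a topology \<Rightarrow> 'a \<Rightarrow> countable_ordinal"
  where "cb_rank X x = (GREATEST \<beta>. \<beta> \<le> cb_height X \<and> x \<in> cb_derivative X \<beta>)"

lemma cb_rank:
  assumes "Hausdorff_space X" "x \<in> topspace X"
  shows cb_rank_le: "cb_rank X x \<le> cb_height X"
    and cb_rank_iff: "\<gamma> \<le> cb_height X \<Longrightarrow> x \<in> cb_derivative X \<gamma> \<longleftrightarrow> \<gamma> \<le> cb_rank X x"
proof -
  obtain \<beta> where \<beta>: "\<beta> \<le> cb_height X" "\<forall>\<gamma>\<le>cb_height X. x \<in> cb_derivative X \<gamma> \<longleftrightarrow> \<gamma> \<le> \<beta>"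
    using cb_rank_exists[OF assms] by blast
  then have "cb_rank X x = \<beta>"
    unfolding cb_rank_def by (intro Greatest_equality) auto
  then show "cb_rank X x \<le> cb_height X"
    "\<gamma> \<le> cb_height X \<Longrightarrow> x \<in> cb_derivative X \<gamma> \<longleftrightarrow> \<gamma> \<le> cb_rank X x"
    using \<beta> by auto
qed

text \<open>
  A point is isolated in the derivative whose order is its rank; this makes the rank drop around
  it. Conversely it is an accumulation point of every earlier derivative, and a point of least
  rank among those of rank at least \<open>\<gamma>\<close> in a neighbourhood must have rank exactly \<open>\<gamma>\<close>.
\<close>
lemma ranked_space_cb_rank:
  assumes X: "compact_space X" "metrizable_space X" "countable (topspace X)"
  shows "ranked_space X (cb_rank X)"
proof -
  let ?rk = "cb_rank X"
  have H: "Hausdorff_space X"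
    by (rule metrizable_imp_Hausdorff_space[OF X(2)])
  have le: "?rk x \<le> cb_height X" if "x \<in> topspace X" for x
    by (rule cb_rank_le[OF H that])
  have mem: "x \<in> cb_derivative X (?rk x)" if "x \<in> topspace X" for x
    using cb_rank_iff[OF H that le[OF that]] by simp
  have isolated: "x \<notin> X derived_set_of cb_derivative X (?rk x)" if x: "x \<in> topspace X" for x
  proof (cases "?rk x = cb_height X")
    case True
    then show ?thesis
      using cb_height_discrete(1)[OF X(1) H X(3)] by simp
  next
    case False
    then have "?rk x < cb_height X"
      using le[OF x] by (rule le_neq_trans[rotated])
    then obtain \<gamma> where \<gamma>: "succ_of (?rk x) \<gamma>" "\<gamma> \<le> cb_height X"
      using succ_of_exists by blast
    have "x \<notin> cb_derivative X \<gamma>"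
      using cb_rank_iff[OF H x \<gamma>(2)] \<gamma>(1) by (simp add: succ_of_def not_le)
    then show ?thesis
      by (simp add: cb_derivative_succ_derived[OF H \<gamma>(1)])
  qed
  have less: "\<exists>U. openin X U \<and> x \<in> U \<and> (\<forall>y\<in>U - {x}. ?rk y < ?rk x)" if x: "x \<in> topspace X" for x
  proof -
    obtain U where U: "openin X U" "x \<in> U" "\<not> (\<exists>y. y \<noteq> x \<and> y \<in> cb_derivative X (?rk x) \<and> y \<in> U)"
      using isolated[OF x] x unfolding in_derived_set_of by blast
    have "?rk y < ?rk x" if y: "y \<in> U - {x}" for y
    proof -
      have "y \<in> topspace X"
        using y U(1) openin_subset by blast
      moreover have "y \<notin> cb_derivative X (?rk x)"
        using U(3) y by blast
      ultimately show ?thesis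
        using cb_rank_iff[OF H _ le[OF x], of y] by (simp add: not_le)
    qed
    then show ?thesis
      using U by blast
  qed
  have attained: "\<exists>y\<in>U. ?rk y = \<gamma>" if U: "openin X U" "x \<in> U" "\<gamma> < ?rk x" for U x \<gamma>
  proof -
    have UX: "U \<subseteq> topspace X"
      using U(1) openin_subset by blast
    have "\<exists>y. y \<in> U \<and> \<gamma> \<le> ?rk y"
      using U by (intro exI[of _ x]) simp
    then have "\<exists>\<beta>. \<exists>y. y \<in> U \<and> \<gamma> \<le> ?rk y \<and> ?rk y = \<beta>"
      by blast
    then obtain \<beta> where \<beta>: "\<exists>y. y \<in> U \<and> \<gamma> \<le> ?rk y \<and> ?rk y = \<beta>"
      "\<And>\<beta>'. \<beta>' < \<beta> \<Longrightarrow> \<not> (\<exists>y. y \<in> U \<and> \<gamma> \<le> ?rk y \<and> ?rk y = \<beta>')"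
      using exists_least_iff[of "\<lambda>\<beta>. \<exists>y. y \<in> U \<and> \<gamma> \<le> ?rk y \<and> ?rk y = \<beta>"] by blast
    then obtain y where y: "y \<in> U" "\<gamma> \<le> ?rk y" "?rk y = \<beta>"
      by blast
    have "?rk y = \<gamma>"
    proof (rule ccontr)
      assume "?rk y \<noteq> \<gamma>"
      then have \<gamma>y: "\<gamma> < ?rk y"
        using y(2) by (simp add: order_le_less)
      obtain V where V: "openin X V" "y \<in> V" "\<forall>z\<in>V - {y}. ?rk z < ?rk y"
        using less y(1) UX by blast
      have "y \<in> X derived_set_of cb_derivative X \<gamma>"
        using mem[of y] y(1) UX cb_derivative_subset_derived[OF H \<gamma>y] by blast
      moreover have "openin X (U \<inter> V)" "y \<in> U \<inter> V"
        using U(1) V(1,2) y(1) by (simp_all add: openin_Int)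
      ultimately obtain z where z: "z \<noteq> y" "z \<in> cb_derivative X \<gamma>" "z \<in> U \<inter> V"
        unfolding in_derived_set_of by blast
      have "\<gamma> \<le> cb_height X"
        using U(3) le[of x] U(2) UX by (meson less_imp_le order_trans subsetD)
      then have "\<gamma> \<le> ?rk z"
        using cb_rank_iff[OF H, of z \<gamma>] z(2,3) UX by blast
      then show False
        using \<beta>(2)[of "?rk z"] V(3) z y(3) by blast
    qed
    then show ?thesis
      using y(1) by blast
  qed
  show ?thesis
  proof
    show "compact_space X" "Hausdorff_space X" "countable (topspace X)"
      by fact+
    show "\<exists>C. openin X C \<and> closedin X C \<and> x \<in> C \<and> C \<subseteq> U" if "openin X U" "x \<in> U" for U x
      using clopen_base_of_countable_metrizable[OF X(2,3) that] .
  qed (use less attained in auto)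
qed

section \<open>Realizing spaces of successor height as attractors\<close>

context ranked_space
begin

text \<open>
  Small cones around the points of maximal rank need not cover the space, but all points
  that they miss have smaller rank and can be added to the first cone.
\<close>
lemma partition_into_cones:
  assumes \<theta>: "\<And>x. x \<in> topspace X \<Longrightarrow> rk x \<le> \<theta>"
    and L: "L = {x \<in> topspace X. rk x = \<theta>}" "finite L" and nonempty: "L = {} \<Longrightarrow> topspace X = {}"
  shows "\<exists>(n::nat) p D. p ` {..<n} = L \<and> (\<forall>k<n. cone (p k) (D k)) \<and>
    (\<forall>j<n. \<forall>k<n. j \<noteq> k \<longrightarrow> D j \<inter> D k = {}) \<and> topspace X = (\<Union>k<n. D k)"
proof -
  obtain p where p: "bij_betw p {..<card L} L"
    using ex_bij_betw_nat_finite[OF L(2)] by (auto simp: atLeast0LessThan)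
  define n where "n = card L"
  have p_L: "p ` {..<n} = L" and p_inj: "inj_on p {..<n}"
    using p by (auto simp: bij_betw_def n_def)
  have "\<exists>C. cone (p k) C \<and> C \<inter> L \<subseteq> {p k}" if "k < n" for k
  proof -
    have pk: "p k \<in> L"
      using that p_L by blast
    have "closedin X (L - {p k})"
      using L Hausdorff by (intro Hausdorff_imp_t1_space[THEN t1_space_closedin_finite[THEN iffD1],
            rule_format]) auto
    then have "openin X (topspace X - (L - {p k}))"
      by (simp add: openin_diff)
    then obtain C where "cone (p k) C" "C \<subseteq> topspace X - (L - {p k})"
      using small_cone[of "topspace X - (L - {p k})" "p k"] pk L(1) by blast
    then show ?thesis
      by blast
  qed
  then obtain E where E: "\<And>k. k < n \<Longrightarrow> cone (p k) (E k) \<and> E k \<inter> L \<subseteq> {p k}"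
    by metis
  \<comment> \<open>The first set takes in the whole space, and each set gives up what later ones contain.\<close>
  define E' where "E' k = (if k = 0 then topspace X else E k)" for k
  define D where "D k = E' k - (\<Union>j\<in>{k<..<n}. E' j)" for k
  have E'_clopen: "openin X (E' k)" "closedin X (E' k)" if "k < n" for k
    using E[OF that] by (auto simp: E'_def cone_def)
  have cone_D: "cone (p k) (D k)" if k: "k < n" for k
  proof -
    have "openin X (D k)" "closedin X (D k)"
      unfolding D_def using E'_clopen k
      by (auto intro!: openin_diff closedin_diff openin_Union closedin_Union)
    moreover have pk: "p k \<in> L"
      using k p_L by blast
    have "p k \<notin> E' j" if j: "j \<in> {k<..<n}" for j
    proof
      assume "p k \<in> E' j"
      then have "p k = p j"
        using E[of j] j pk by (auto simp: E'_def split: if_splits)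
      then show False
        using p_inj k j by (auto dest: inj_onD)
    qed
    moreover have "p k \<in> E' k"
      using E[OF k] pk L(1) by (auto simp: E'_def cone_def)
    moreover have "rk y < rk (p k)" if y: "y \<in> D k - {p k}" for y
    proof -
      have yX: "y \<in> topspace X"
        using y E'_clopen(1)[OF k] openin_subset by (auto simp: D_def)
      have "y \<notin> L"
      proof
        assume yL: "y \<in> L"
        then obtain j where j: "j < n" "y = p j"
          using p_L by blast
        then have "p j \<in> E' j"
          using E[OF j(1)] yX by (auto simp: E'_def cone_def)
        then have "\<not> k < j"
          using y j by (auto simp: D_def)
        moreover have "j \<noteq> k"
          using y j(2) by blast
        ultimately have "0 < k"
          by simp
        then have "y \<in> E k \<inter> L"
          using y yL by (auto simp: D_def E'_def split: if_splits)
        then show False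
          using E[OF k] y by blast
      qed
      then have "rk y < \<theta>"
        using yX \<theta> L(1) by (auto simp: order_le_less)
      then show ?thesis
        using pk L(1) by simp
    qed
    ultimately show ?thesis
      unfolding cone_def D_def by blast
  qed
  have disj: "D j \<inter> D k = {}" if "j < n" "k < n" "j \<noteq> k" for j k
    using that by (cases j k rule: linorder_cases) (auto simp: D_def)
  have "x \<in> (\<Union>k<n. D k)" if x: "x \<in> topspace X" for x
  proof -
    have "0 < n"
      using nonempty x p_L by (cases n) auto
    then have "\<exists>k. k < n \<and> x \<in> E' k"
      using x by (intro exI[of _ 0]) (simp add: E'_def)
    moreover have bound: "\<forall>k. k < n \<and> x \<in> E' k \<longrightarrow> k \<le> n"
      by simp
    ultimately have "\<exists>k. (k < n \<and> x \<in> E' k) \<and> (\<forall>j. j < n \<and> x \<in> E' j \<longrightarrow> j \<le> k)"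
      using ex_has_greatest_nat[of "\<lambda>k. k < n \<and> x \<in> E' k" _ "\<lambda>k. k" n] by auto
    then show ?thesis
      by (fastforce simp: D_def)
  qed
  moreover have "D k \<subseteq> topspace X" if "k < n" for k
    using cone_D[OF that] openin_subset by (auto simp: cone_def)
  ultimately have "topspace X = (\<Union>k<n. D k)"
    by blast
  then show ?thesis
    using p_L cone_D disj by blast
qed

end

lemma infinitely_recurring_enumeration:
  assumes "countable A"
  shows "\<exists>a :: nat \<Rightarrow> 'b. \<forall>x\<in>A. infinite {k. a k = x}"
proof -
  define a where "a k = from_nat_into A (fst (prod_decode k))" for k
  have "infinite {k. a k = x}" if x: "x \<in> A" for x
  proof -
    have "range (\<lambda>m. prod_encode (to_nat_on A x, m)) \<subseteq> {k. a k = x}"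
      using from_nat_into_to_nat_on[OF assms x] by (auto simp: a_def)
    moreover have "infinite (range (\<lambda>m :: nat. prod_encode (to_nat_on A x, m)))"
      by (rule range_inj_infinite) (auto simp: inj_on_def)
    ultimately show ?thesis
      using infinite_super by blast
  qed
  then show ?thesis
    by blast
qed

lemma topological_IFS_attractor_of_homeomorphic:
  assumes Y: "IFS_attractor (Y :: 'b metric)" and hom: "(X :: 'a topology) homeomorphic_space mtopology_of Y"
  shows "topological_IFS_attractor X"
proof -
  obtain h where h: "homeomorphic_map X (mtopology_of Y) h"
    using hom homeomorphic_space by blast
  have inj: "inj_on h (topspace X)" and im: "h ` topspace X = mspace Y"
    using homeomorphic_imp_injective_map[OF h] homeomorphic_imp_surjective_map[OF h] by auto
  define M where "M = topspace X"
  define d where "d x y = mdist Y (h x) (h y)" for x y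
  have hM: "h x \<in> mspace Y" if "x \<in> M" for x
    using im that by (auto simp: M_def)
  have M: "Metric_space M d"
  proof
    show "d x y = 0 \<longleftrightarrow> x = y" if "x \<in> M" "y \<in> M" for x y
      using that hM inj by (auto simp: d_def M_def inj_on_def)
    show "d x z \<le> d x y + d y z" if "x \<in> M" "y \<in> M" "z \<in> M" for x y z
      using that hM by (simp add: d_def mdist_triangle)
  qed (auto simp: d_def mdist_commute)
  define m where "m = metric (M, d)"
  have m: "mspace m = M" "mdist m = d"
    using M by (simp_all add: m_def Metric_space.mspace_metric Metric_space.mdist_metric)
  have "homeomorphic_map (mtopology_of m) (mtopology_of Y) h"
    unfolding mtopology_of_def m
  proof (rule Metric_space12.isometry_imp_homeomorphic_map)
    show "Metric_space12 M d (mspace Y) (mdist Y)"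
      using M by (simp add: Metric_space12_def)
  qed (use im in \<open>auto simp: M_def d_def\<close>)
  then have hom_m: "mtopology_of m homeomorphic_space mtopology_of Y"
    using homeomorphic_space by blast
  define g where "g = inv_into M h"
  have g: "g y \<in> M" "h (g y) = y" if "y \<in> mspace Y" for y
    using that im unfolding g_def M_def by (auto simp: inv_into_into f_inv_into_f)
  have gh: "g (h x) = x" if "x \<in> M" for x
    using that inj by (simp add: g_def M_def)
  obtain F where F: "finite F" "\<forall>f\<in>F. contraction Y f" "mspace Y = (\<Union>f\<in>F. f ` mspace Y)"
    using Y unfolding IFS_attractor_def by blast
  have "contraction m (g \<circ> f \<circ> h)" if "f \<in> F" for f
  proof -
    have f: "f ` mspace Y \<subseteq> mspace Y" "\<exists>\<alpha>. 0 < \<alpha> \<and> \<alpha> < 1 \<and>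
      (\<forall>x\<in>mspace Y. \<forall>y\<in>mspace Y. mdist Y (f x) (f y) \<le> \<alpha> * mdist Y x y)"
      using F(2) that by (auto simp: contraction_def)
    have fh: "f (h x) \<in> mspace Y" if "x \<in> M" for x
      using f(1) hM[OF that] by blast
    have "(g \<circ> f \<circ> h) ` M \<subseteq> M"
      using fh g by auto
    moreover have "d ((g \<circ> f \<circ> h) x) ((g \<circ> f \<circ> h) y) = mdist Y (f (h x)) (f (h y))"
      if "x \<in> M" "y \<in> M" for x y
      using that fh g by (simp add: d_def)
    ultimately show ?thesis
      unfolding contraction_def m using f(2) hM by (auto simp: d_def)
  qed
  moreover have "M = (\<Union>f\<in>F. (g \<circ> f \<circ> h) ` M)"
  proof -
    have gM: "g ` mspace Y = M"
      using g(1) gh hM by force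
    have "(\<Union>f\<in>F. (g \<circ> f \<circ> h) ` M) = g ` (\<Union>f\<in>F. f ` h ` M)"
      by (auto simp: image_iff)
    also have "\<dots> = M"
      using im F(3) gM by (simp add: M_def)
    finally show ?thesis ..
  qed
  moreover have "compact_space (mtopology_of m)"
    using Y hom_m homeomorphic_compact_space unfolding IFS_attractor_def by blast
  ultimately have "IFS_attractor m"
    unfolding IFS_attractor_def m using F(1)
    by (intro conjI exI[of _ "(\<lambda>f. g \<circ> f \<circ> h) ` F"]) auto
  moreover have "X homeomorphic_space mtopology_of m"
    using hom hom_m homeomorphic_space_sym homeomorphic_space_trans by blast
  ultimately show ?thesis
    unfolding topological_IFS_attractor_def by blast
qed

text \<open>
  The labels are obtained by enumerating the ordinals below \<open>\<delta>\<close>. There are countably many, because each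
  of them is the rank of some point near a point of maximal rank. For height \<open>0\<close> the cones are
  singletons.
\<close>
lemma exists_real_attractor:
  assumes X: "compact_space X" "metrizable_space X" "countable (topspace X)"
    and height: "cb_height X = 0 \<or> successor_ordinal (cb_height X)"
  shows "\<exists>Y :: real set. compact Y \<and> IFS_attractor (submetric euclidean_metric Y) \<and>
    X homeomorphic_space top_of_set Y"
proof -
  let ?\<theta> = "cb_height X"
  interpret ranked_space X "cb_rank X"
    by (rule ranked_space_cb_rank[OF X])
  define L where "L = cb_derivative X ?\<theta>"
  have le: "cb_rank X x \<le> ?\<theta>" if "x \<in> topspace X" for x
    by (rule cb_rank_le[OF Hausdorff that])
  have L_eq: "L = {x \<in> topspace X. cb_rank X x = ?\<theta>}"
  proof -
    have "x \<in> L \<longleftrightarrow> cb_rank X x = ?\<theta>" if "x \<in> topspace X" for x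
      using cb_rank_iff[OF Hausdorff that order_refl] le[OF that] unfolding L_def by auto
    then show ?thesis
      using cb_derivative_subset_topspace[OF Hausdorff] unfolding L_def by blast
  qed
  have L_finite: "finite L"
    unfolding L_def by (rule finite_cb_height_derivative[OF compact Hausdorff countable])
  have L_nonempty: "L \<noteq> {}" if succ: "succ_of \<delta> ?\<theta>" for \<delta>
    using cb_height_discrete(2)[OF compact Hausdorff countable, of \<delta>] succ
    by (simp add: L_def cb_derivative_succ_derived[OF Hausdorff succ] succ_of_def)
  have empty: "topspace X = {}" if "L = {}"
    using height that L_nonempty by (auto simp: successor_ordinal_def L_def cb_derivative_0)
  have "\<exists>(n::nat) p D. p ` {..<n} = L \<and> (\<forall>k<n. cone (p k) (D k)) \<and>
    (\<forall>j<n. \<forall>k<n. j \<noteq> k \<longrightarrow> D j \<inter> D k = {}) \<and> topspace X = (\<Union>k<n. D k)"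
    by (rule partition_into_cones[OF le L_eq L_finite empty])
  then obtain n :: nat and p D where p: "p ` {..<n} = L" and cones: "\<forall>k<n. cone (p k) (D k)"
    and disj: "\<forall>j<n. \<forall>k<n. j \<noteq> k \<longrightarrow> D j \<inter> D k = {}" and cover: "topspace X = (\<Union>k<n. D k)"
    by (elim exE conjE) (rule that)
  have "\<exists>S F. half_ifs S F \<and> S \<subseteq> {0..1} \<and> (\<forall>q C. cone q C \<and> cb_rank X q = ?\<theta> \<longrightarrow>
    subtopology X C homeomorphic_space top_of_set S)"
    using height
  proof
    assume zero: "?\<theta> = 0"
    have no_less: "\<not> \<gamma> < 0" for \<gamma> :: countable_ordinal
      using zero_le_countable_ordinal by (simp add: not_less)
    have "model (\<lambda>k. 0 :: countable_ordinal) 0 = {0}"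
      by (subst model_unfold) (simp add: no_less)
    then have "subtopology X C homeomorphic_space top_of_set {0 :: real}"
      if "cone q C" "cb_rank X q = ?\<theta>" for q C
      using cone_homeomorphic_model[where \<delta> = 0 and a = "\<lambda>k. 0", OF _ that(1)] that(2) no_less
      by (simp add: zero)
    moreover have "half_ifs {0} {\<lambda>x. 0}"
      by (simp add: half_ifs_def)
    ultimately show ?thesis
      by (intro exI[of _ "{0}"] exI[of _ "{\<lambda>x. 0}"]) auto
  next
    assume "successor_ordinal ?\<theta>"
    then obtain \<delta> where succ: "succ_of \<delta> ?\<theta>"
      by (auto simp: successor_ordinal_def)
    then have \<delta>: "\<delta> < ?\<theta>" "\<And>\<gamma>. \<gamma> < ?\<theta> \<Longrightarrow> \<gamma> \<le> \<delta>"
      by (auto simp: succ_of_def)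
    obtain q where q: "q \<in> topspace X" "cb_rank X q = ?\<theta>"
      using L_nonempty[OF succ] L_eq by blast
    have "\<gamma> \<in> cb_rank X ` topspace X" if "\<gamma> < \<delta>" for \<gamma>
    proof -
      have "\<gamma> < cb_rank X q"
        using that \<delta>(1) q(2) by (simp add: less_trans)
      then show ?thesis
        using rank_attained[OF openin_topspace q(1)] by blast
    qed
    then have "{..<\<delta>} \<subseteq> cb_rank X ` topspace X"
      by blast
    then have "countable {..<\<delta>}"
      using countable by (meson countable_image countable_subset)
    then obtain a :: "nat \<Rightarrow> countable_ordinal" where a: "\<forall>\<gamma>\<in>{..<\<delta>}. infinite {k. a k = \<gamma>}"
      using infinitely_recurring_enumeration by blast
    let ?S = "insert 0 (\<Union>k. shrink k ` model a \<delta>)"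
    have "subtopology X C homeomorphic_space top_of_set ?S"
      if "cone q C" "cb_rank X q = ?\<theta>" for q C
      using cone_homeomorphic_successor_model[where \<delta> = \<delta> and a = a, OF _ that(1)] a \<delta> that(2)
      by simp
    then show ?thesis
      using successor_model_half_ifs[of a \<delta>] successor_model_subset[of a \<delta>] by blast
  qed
  then obtain S F where S: "half_ifs S F" "S \<subseteq> {0..1}"
    and homeo: "\<And>q C. \<lbrakk>cone q C; cb_rank X q = ?\<theta>\<rbrakk> \<Longrightarrow>
      subtopology X C homeomorphic_space top_of_set S"
    by blast
  define T where "T = (\<Union>k<n. (\<lambda>x. x + 2 * real k) ` S)"
  have XT: "X homeomorphic_space top_of_set T"
    unfolding T_def
  proof (rule glue_finitely_many[OF compact _ _ cover])
    fix k assume k: "k < n"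
    have "cone (p k) (D k)" "p k \<in> L"
      using k cones p by auto
    then show "openin X (D k) \<and> closedin X (D k)"
      "subtopology X (D k) homeomorphic_space top_of_set S"
      using homeo L_eq by (auto simp: cone_def)
  qed (use disj S in auto)
  have "compact T"
    using homeomorphic_compact_space[OF XT] compact
    by (simp add: compactin_euclidean_iff[symmetric] compactin_subspace)
  moreover from this have "IFS_attractor (submetric euclidean_metric T)"
    using translates_IFS_attractor[OF S] by (simp add: T_def)
  ultimately show ?thesis
    using XT by blast
qed

theorem corollary1:
  fixes X :: "'a topology"
  assumes "countable (topspace X)" and "compact_space X" and "metrizable_space X"
  shows "(topological_IFS_attractor X \<longleftrightarrow>
            cb_height X = 0 \<or> successor_ordinal (cb_height X)) \<and>
         (topological_IFS_attractor X \<longrightarrow>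
            (\<exists>Y :: real set. compact Y \<and>
               IFS_attractor (submetric euclidean_metric Y) \<and>
               X homeomorphic_space top_of_set Y))"
proof -
  have height: "cb_height X = 0 \<or> successor_ordinal (cb_height X)"
    if attractor: "topological_IFS_attractor X"
  proof -
    obtain Y :: "'a metric" where Y: "IFS_attractor Y" "X homeomorphic_space mtopology_of Y"
      using attractor unfolding topological_IFS_attractor_def by blast
    obtain h where "homeomorphic_map X (mtopology_of Y) h"
      using Y(2) homeomorphic_space by blast
    then have "h ` topspace X = mspace Y"
      using homeomorphic_imp_surjective_map by fastforce
    then have "countable (mspace Y)"
      using assms(1) by (metis countable_image)
    then show ?thesis
      using attractor_height[OF Y(1)]
        homeomorphic_cb_height[OF Y(2) metrizable_imp_Hausdorff_space[OF assms(3)]] by simp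
  qed
  have real: "\<exists>Y :: real set. compact Y \<and> IFS_attractor (submetric euclidean_metric Y) \<and>
      X homeomorphic_space top_of_set Y"
    if "cb_height X = 0 \<or> successor_ordinal (cb_height X)"
    using exists_real_attractor[OF assms(2,3,1) that] .
  have "topological_IFS_attractor X"
    if height: "cb_height X = 0 \<or> successor_ordinal (cb_height X)"
  proof -
    obtain Y :: "real set" where "IFS_attractor (submetric euclidean_metric Y)"
      "X homeomorphic_space top_of_set Y"
      using real[OF height] by blast
    then show ?thesis
      using topological_IFS_attractor_of_homeomorphic[of "submetric euclidean_metric Y" X]
      by (simp add: mtopology_of_submetric)
  qed
  then show ?thesis
    using height real by blast
qed

end
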